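(* Let $\mathbb F$ be an algebraically closed field, $G$ a Cayley bigraph on a finite group $\mathcal G$, $L$ a subgraph of $G$, and $0\le k\le\rho(L)$. Then the generic maximum excess of $(L,G,\mathcal G,\mathbb F,k)$ is divisible by $|\mathcal G|$.
   Context: Cayley bigraph on $\mathcal G$ with generators $g_1,g_2$: $V_G=\mathcal G$, $E_G=\mathcal G\times\{1,2\}$, edge $(g,i)$ has tail $g$, head $g_ig$. For $x\in\mathcal G$ and a subgraph $L$, $Lx$ is the image of $L$ under $g\mapsto gx$, $(g,i)\mapsto(gx,i)$; for $P\in V_G\sqcup E_G$, $\mathcal G_L(P)=\{x\in\mathcal G:P\in Lx\}$. For $k\ge0$ and $M\in\mathbb F^{k\times\mathcal G}$ with columns $m^x$, $M$ is $L$-surjective if for every $P$ the columns $m^x$, $x\in\mathcal G_L(P)$, span $\mathbb F^k$; then $\mathcal K_M(L)$ is the sheaf on $G$ with $\mathcal K_M(L)(P)=\{a\in\mathbb F^{\mathcal G}:a_x=0\ \forall x\notin\mathcal G_L(P),\ \sum_xa_xm^x=0\}$ and restriction maps the inclusions. The generic maximum excess of $(L,G,\mathcal G,\mathbb F,k)$ (for $k\le\rho(L)$) is the largest integer $m$ such that the set of $L$-surjective $M\in\mathbb F^{k\times\mathcal G}$ with ${\rm m.e.}(\mathcal K_M(L))\ge m$ is Zariski dense in $\mathbb F^{k\times\mathcal G}$. Maximum excess of a sheaf $\mathcal F$: with $\mathcal F(V)=\bigoplus_v\mathcal F(v)$, $d_h,d_t$ sending $\mathcal F(e)$ into $\mathcal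 F(he)$, $\mathcal F(te)$ by the restriction maps, $\Gamma_{\rm ht}(U)=\bigoplus_e\{w\in\mathcal F(e):d_hw,d_tw\in U\}$ and ${\rm m.e.}(\mathcal F)=\max_{U\subset\mathcal F(V)}(\dim\Gamma_{\rm ht}(U)-\dim U)$. $\rho(L)=\sum_X\max(0,|E_X|-|V_X|)$ over connected components $X$ of $L$ as an undirected graph. *)

theory Defs
  imports "HOL-Algebra.Group" "HOL-Computational_Algebra.Polynomial" "HOL-Library.Function_Algebras"
begin

definition algebraically_closed :: "'a::field itself \<Rightarrow> bool" where
  "algebraically_closed _ \<longleftrightarrow> (\<forall>p::'a poly. degree p > 0 \<longrightarrow> (\<exists>x. poly p x = 0))"

definition cay_edges :: "('g,'b) monoid_scheme \<Rightarrow> ('g \<times> nat) set" where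
  "cay_edges Gr = carrier Gr \<times> {1, 2}"

definition cay_tail :: "'g \<times> nat \<Rightarrow> 'g" where
  "cay_tail e = fst e"

definition cay_head :: "('g,'b) monoid_scheme \<Rightarrow> 'g \<Rightarrow> 'g \<Rightarrow> 'g \<times> nat \<Rightarrow> 'g" where
  "cay_head Gr g1 g2 e = (if snd e = 1 then g1 else g2) \<otimes>\<^bsub>Gr\<^esub> fst e"

definition is_subgraph ::
  "('g,'b) monoid_scheme \<Rightarrow> 'g \<Rightarrow> 'g \<Rightarrow> 'g set \<Rightarrow> ('g \<times> nat) set \<Rightarrow> bool" where
  "is_subgraph Gr g1 g2 VL EL \<longleftrightarrow>
     VL \<subseteq> carrier Gr \<and> EL \<subseteq> cay_edges Gr \<and>
     (\<forall>e\<in>EL. cay_tail e \<in> VL \<and> cay_head Gr g1 g2 e \<in> VL)"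

definition transl_V :: "('g,'b) monoid_scheme \<Rightarrow> 'g set \<Rightarrow> 'g \<Rightarrow> 'g set" where
  "transl_V Gr VL x = (\<lambda>g. g \<otimes>\<^bsub>Gr\<^esub> x) ` VL"

definition transl_E :: "('g,'b) monoid_scheme \<Rightarrow> ('g \<times> nat) set \<Rightarrow> 'g \<Rightarrow> ('g \<times> nat) set" where
  "transl_E Gr EL x = (\<lambda>(g, i). (g \<otimes>\<^bsub>Gr\<^esub> x, i)) ` EL"

definition cay_points :: "('g,'b) monoid_scheme \<Rightarrow> ('g + 'g \<times> nat) set" where
  "cay_points Gr = Inl ` carrier Gr \<union> Inr ` cay_edges Gr"

definition in_transl :: "('g,'b) monoid_scheme \<Rightarrow> 'g set \<Rightarrow> ('g \<times> nat) set \<Rightarrow> 'g \<Rightarrow> ('g + 'g \<times> nat) \<Rightarrow> bool" where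
  "in_transl Gr VL EL x P = (case P of Inl v \<Rightarrow> v \<in> transl_V Gr VL x | Inr e \<Rightarrow> e \<in> transl_E Gr EL x)"

definition GL :: "('g,'b) monoid_scheme \<Rightarrow> 'g set \<Rightarrow> ('g \<times> nat) set \<Rightarrow> ('g + 'g \<times> nat) \<Rightarrow> 'g set" where
  "GL Gr VL EL P = {x \<in> carrier Gr. in_transl Gr VL EL x P}"

definition und_adj :: "('g,'b) monoid_scheme \<Rightarrow> 'g \<Rightarrow> 'g \<Rightarrow> ('g \<times> nat) set \<Rightarrow> 'g \<Rightarrow> 'g \<Rightarrow> bool" where
  "und_adj Gr g1 g2 EL u v \<longleftrightarrow>
     (\<exists>e\<in>EL. (cay_tail e = u \<and> cay_head Gr g1 g2 e = v) \<or> (cay_tail e = v \<and> cay_head Gr g1 g2 e = u))"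

definition components :: "('g,'b) monoid_scheme \<Rightarrow> 'g \<Rightarrow> 'g \<Rightarrow> 'g set \<Rightarrow> ('g \<times> nat) set \<Rightarrow> 'g set set" where
  "components Gr g1 g2 VL EL =
     (\<lambda>u. {w \<in> VL. (und_adj Gr g1 g2 EL)\<^sup>*\<^sup>* u w}) ` VL"

definition rho :: "('g,'b) monoid_scheme \<Rightarrow> 'g \<Rightarrow> 'g \<Rightarrow> 'g set \<Rightarrow> ('g \<times> nat) set \<Rightarrow> int" where
  "rho Gr g1 g2 VL EL =
     (\<Sum>X\<in>components Gr g1 g2 VL EL.
        max 0 (int (card {e \<in> EL. cay_tail e \<in> X}) - int (card X)))"

section \<open>Matrices M \<in> \<FF>^(k \<times> \<G>), M i x = i-th entry of column m^x\<close>

definition mats :: "('g,'b) monoid_scheme \<Rightarrow> nat \<Rightarrow> (nat \<Rightarrow> 'g \<Rightarrow> 'a::field) set" where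
  "mats Gr k = {M. \<forall>i x. (i \<ge> k \<or> x \<notin> carrier Gr) \<longrightarrow> M i x = 0}"

definition L_surjective ::
  "('g,'b) monoid_scheme \<Rightarrow> 'g set \<Rightarrow> ('g \<times> nat) set \<Rightarrow> nat \<Rightarrow> (nat \<Rightarrow> 'g \<Rightarrow> 'a::field) \<Rightarrow> bool" where
  "L_surjective Gr VL EL k M \<longleftrightarrow>
     (\<forall>P\<in>cay_points Gr. \<forall>v::nat \<Rightarrow> 'a. \<exists>a::'g \<Rightarrow> 'a.
        \<forall>i<k. v i = (\<Sum>x\<in>GL Gr VL EL P. a x * M i x))"

text \<open>The sheaf K_M(L): value at P (restriction maps are inclusions).\<close>

definition K_sheaf ::
  "('g,'b) monoid_scheme \<Rightarrow> 'g set \<Rightarrow> ('g \<times> nat) set \<Rightarrow> nat \<Rightarrow> (nat \<Rightarrow> 'g \<Rightarrow> 'a::field)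
     \<Rightarrow> ('g + 'g \<times> nat) \<Rightarrow> ('g \<Rightarrow> 'a) set" where
  "K_sheaf Gr VL EL k M P =
     {a. (\<forall>x. x \<notin> GL Gr VL EL P \<longrightarrow> a x = 0) \<and>
         (\<forall>i<k. (\<Sum>x\<in>carrier Gr. a x * M i x) = 0)}"

section \<open>Maximum excess of a sheaf whose values are subspaces of \<FF>^\<G> and whose
  restriction maps are inclusions\<close>

definition fscale :: "'a::field \<Rightarrow> ('v \<Rightarrow> 'g \<Rightarrow> 'a) \<Rightarrow> ('v \<Rightarrow> 'g \<Rightarrow> 'a)" where
  "fscale c f = (\<lambda>v x. c * f v x)"

text \<open>\<F>(V) = \<Oplus>_v \<F>(v), realised as functions on V (zero off V).\<close>

definition sheaf_V :: "'v set \<Rightarrow> ('v \<Rightarrow> ('g \<Rightarrow> 'a::field) set) \<Rightarrow> ('v \<Rightarrow> 'g \<Rightarrow> 'a) set" where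
  "sheaf_V V Fv = {f. (\<forall>v\<in>V. f v \<in> Fv v) \<and> (\<forall>v. v \<notin> V \<longrightarrow> f v = 0)}"

text \<open>d_h w / d_t w: w placed in the component of the head / tail vertex.\<close>

definition place :: "'v \<Rightarrow> ('g \<Rightarrow> 'a::field) \<Rightarrow> ('v \<Rightarrow> 'g \<Rightarrow> 'a)" where
  "place v w = (\<lambda>u. if u = v then w else 0)"

definition Gamma_ht ::
  "'e set \<Rightarrow> ('e \<Rightarrow> 'v) \<Rightarrow> ('e \<Rightarrow> 'v) \<Rightarrow> ('e \<Rightarrow> ('g \<Rightarrow> 'a::field) set)
     \<Rightarrow> ('v \<Rightarrow> 'g \<Rightarrow> 'a) set \<Rightarrow> ('e \<Rightarrow> 'g \<Rightarrow> 'a) set" where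
  "Gamma_ht E hdE tlE Fe U =
     {f. (\<forall>e\<in>E. f e \<in> Fe e \<and> place (hdE e) (f e) \<in> U \<and> place (tlE e) (f e) \<in> U) \<and>
         (\<forall>e. e \<notin> E \<longrightarrow> f e = 0)}"

definition max_excess ::
  "'v set \<Rightarrow> 'e set \<Rightarrow> ('e \<Rightarrow> 'v) \<Rightarrow> ('e \<Rightarrow> 'v) \<Rightarrow> ('v \<Rightarrow> ('g \<Rightarrow> 'a::field) set)
     \<Rightarrow> ('e \<Rightarrow> ('g \<Rightarrow> 'a) set) \<Rightarrow> int" where
  "max_excess V E hdE tlE Fv Fe =
     Max {int (vector_space.dim fscale (Gamma_ht E hdE tlE Fe U)) - int (vector_space.dim fscale U)
          | U. module.subspace fscale U \<and> U \<subseteq> sheaf_V V Fv}"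

definition me_K ::
  "('g,'b) monoid_scheme \<Rightarrow> 'g \<Rightarrow> 'g \<Rightarrow> 'g set \<Rightarrow> ('g \<times> nat) set \<Rightarrow> nat
     \<Rightarrow> (nat \<Rightarrow> 'g \<Rightarrow> 'a::field) \<Rightarrow> int" where
  "me_K Gr g1 g2 VL EL k M =
     max_excess (carrier Gr) (cay_edges Gr) (cay_head Gr g1 g2) cay_tail
       (\<lambda>v. K_sheaf Gr VL EL k M (Inl v)) (\<lambda>e. K_sheaf Gr VL EL k M (Inr e))"

inductive_set polyfun :: "('g,'b) monoid_scheme \<Rightarrow> nat \<Rightarrow> ((nat \<Rightarrow> 'g \<Rightarrow> 'a::field) \<Rightarrow> 'a) set"
  for Gr k where
  pf_const: "(\<lambda>M. c) \<in> polyfun Gr k"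
| pf_var: "i < k \<Longrightarrow> x \<in> carrier Gr \<Longrightarrow> (\<lambda>M. M i x) \<in> polyfun Gr k"
| pf_add: "p \<in> polyfun Gr k \<Longrightarrow> q \<in> polyfun Gr k \<Longrightarrow> (\<lambda>M. p M + q M) \<in> polyfun Gr k"
| pf_mult: "p \<in> polyfun Gr k \<Longrightarrow> q \<in> polyfun Gr k \<Longrightarrow> (\<lambda>M. p M * q M) \<in> polyfun Gr k"

definition zariski_dense :: "('g,'b) monoid_scheme \<Rightarrow> nat \<Rightarrow> (nat \<Rightarrow> 'g \<Rightarrow> 'a::field) set \<Rightarrow> bool" where
  "zariski_dense Gr k S \<longleftrightarrow> S \<subseteq> mats Gr k \<and>
     (\<forall>p\<in>polyfun Gr k. (\<forall>M\<in>S. p M = 0) \<longrightarrow> (\<forall>M\<in>mats Gr k. p M = 0))"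

definition generic_me ::
  "'a::field itself \<Rightarrow> ('g,'b) monoid_scheme \<Rightarrow> 'g \<Rightarrow> 'g \<Rightarrow> 'g set \<Rightarrow> ('g \<times> nat) set \<Rightarrow> nat \<Rightarrow> int" where
  "generic_me _ Gr g1 g2 VL EL k =
     (GREATEST m::int. zariski_dense Gr k
        {M::nat \<Rightarrow> 'g \<Rightarrow> 'a. M \<in> mats Gr k \<and> L_surjective Gr VL EL k M \<and> me_K Gr g1 g2 VL EL k M \<ge> m})"

end

theory Submission
  imports Defs "Jordan_Normal_Form.Determinant"
begin

text \<open>
  The maximum excess of a sheaf is the maximum, over its subsheaves \<open>A\<close>, of the number
  \<open>\<Sum>\<^sub>e dim A(e) - \<Sum>\<^sub>v dim A(v)\<close>. This quantity is modular on the lattice of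
  subsheaves, so among the maximisers there is one whose stalk dimensions are least at every point.
  There are only finitely many possible dimension vectors and the space of matrices is irreducible,
  hence some vector \<open>d\<close> is the least maximising one for a dense set of \<open>M\<close>.
  The set of \<open>M\<close> whose sheaf has a subsheaf with a given dimension vector is a projection of
  an algebraic set, so by quantifier elimination over algebraically closed fields it is constructible,
  and if it is dense it contains a nonempty open set. Permuting the columns of \<open>M\<close> by right
  translation shows that for every translate of \<open>d\<close> this set is dense. Hence some \<open>M\<close>
  has \<open>d\<close> as least dimension vector and also has a maximiser with the translated
  vector, so \<open>d\<close> is bounded by its translates and therefore invariant. As the group acts simply
  transitively on the vertices and on the edges of each colour, the excess is a multiple of its order.
\<close>

section \<open>Elimination of quantifiers over algebraically closed fields\<close>

text \<open>Two dense sets of matrices can be disjoint, and this obstacle shapes the proof. That a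
  vector is the least maximising one is a condition with a quantifier over all competing subsheaves,
  and the set where it holds is handled only as a dense set. Admitting some subsheaf of given
  dimensions is a weaker, purely existential condition, to which Chevalley's theorem applies. The
  argument therefore pairs the strong condition for \<open>d\<close>, on a dense set, with the weak
  condition for a translate of \<open>d\<close>, on an open set, and these must meet. A translate
  has the same excess as \<open>d\<close>, so at a common matrix it competes with the least vector.
  The bound by rho is what makes the generic value well defined: it ensures that every point lies in
  at least \<open>k\<close> translates of \<open>L\<close>, so surjective matrices are dense and
  level 0 is admissible. Right translation is the symmetry in play because the generators multiply
  on the left.\<close>

lemma algebraically_closed_root:
  assumes "algebraically_closed TYPE('a::field)" "degree (p::'a poly) > 0"
  obtains x where "poly p x = 0"
  using assms unfolding algebraically_closed_def by blast

text \<open>Over a finite field, one plus the product of all \<open>X - a\<close> would have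
  positive degree and no root.\<close>

lemma algebraically_closed_infinite:
  assumes "algebraically_closed TYPE('a::field)"
  shows "infinite (UNIV :: 'a set)"
proof
  assume fin: "finite (UNIV :: 'a set)"
  define p :: "'a poly" where "p = (\<Prod>a\<in>UNIV. [:-a, 1:]) + 1"
  have "degree (\<Prod>a\<in>(UNIV::'a set). [:-a, 1:]) = card (UNIV::'a set)"
    by (subst degree_prod_sum_eq) auto
  moreover have "card (UNIV::'a set) > 0" using fin by (simp add: card_gt_0_iff)
  ultimately have "degree p > 0" unfolding p_def by (subst degree_add_eq_left) auto
  then obtain x where "poly p x = 0" using assms algebraically_closed_root by blast
  moreover have "poly (\<Prod>a\<in>(UNIV::'a set). [:-a, 1:]) x = 0"
    unfolding poly_prod using fin by (intro prod_zero) auto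
  ultimately show False by (simp add: p_def)
qed

text \<open>One-variable Nullstellensatz. Each root of \<open>p\<close> splits off a linear factor
  that divides one copy of \<open>q\<close>, so \<open>degree p\<close> copies suffice. It turns a
  statement about roots into divisibility, which division with remainder can test.\<close>

lemma algebraically_closed_dvd_power:
  fixes p q :: "'a::field poly"
  assumes ac: "algebraically_closed TYPE('a)" and "p \<noteq> 0"
    and "\<And>y. poly p y = 0 \<Longrightarrow> poly q y = 0"
  shows "p dvd q ^ degree p"
  using assms(2,3)
proof (induction "degree p" arbitrary: p)
  case 0
  then show ?case by (simp add: is_unit_iff_degree)
next
  case (Suc n)
  from Suc.hyps(2) algebraically_closed_root[OF ac, of p] obtain a where a: "poly p a = 0"
    by auto
  then obtain r where r: "p = [:-a, 1:] * r" by (auto simp: poly_eq_0_iff_dvd elim: dvdE)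
  have "r \<noteq> 0" using r Suc.prems by auto
  then have "degree p = Suc (degree r)" unfolding r by (subst degree_mult_eq) auto
  then have n: "n = degree r" using Suc.hyps(2) by simp
  have "r dvd q ^ degree r"
    by (rule Suc.hyps(1)[OF n]) (use \<open>r \<noteq> 0\<close> Suc.prems(2) r in auto)
  moreover have "[:-a, 1:] dvd q" using Suc.prems(2)[OF a] by (simp add: poly_eq_0_iff_dvd)
  ultimately have "[:-a, 1:] * r dvd q * q ^ degree r" by (rule mult_dvd_mono[rotated])
  then show ?case using \<open>degree p = Suc (degree r)\<close> r by simp
qed

section \<open>Polynomial maps and constructible sets\<close>

text \<open>The index type of the variables may be infinite, while each map involves finitely many
  of them. Eliminations thus stay in one type and no number of variables has to be tracked.\<close>

inductive_set polynomial_maps :: "(('v \<Rightarrow> 'a::field) \<Rightarrow> 'a) set" where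
  const: "(\<lambda>x. c) \<in> polynomial_maps"
| var: "(\<lambda>x. x v) \<in> polynomial_maps"
| add: "p \<in> polynomial_maps \<Longrightarrow> q \<in> polynomial_maps \<Longrightarrow> (\<lambda>x. p x + q x) \<in> polynomial_maps"
| mult: "p \<in> polynomial_maps \<Longrightarrow> q \<in> polynomial_maps \<Longrightarrow> (\<lambda>x. p x * q x) \<in> polynomial_maps"

lemma polynomial_maps_diff:
  assumes "p \<in> polynomial_maps" "q \<in> polynomial_maps"
  shows "(\<lambda>x. p x - q x) \<in> polynomial_maps"
  using polynomial_maps.add[OF assms(1) polynomial_maps.mult[OF polynomial_maps.const[of "-1"] assms(2)]]
  by simp

lemma polynomial_maps_sum:
  "(\<And>i. i \<in> I \<Longrightarrow> p i \<in> polynomial_maps) \<Longrightarrow> (\<lambda>x. \<Sum>i\<in>I. p i x) \<in> polynomial_maps"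
  by (induction I rule: infinite_finite_induct) (auto intro: polynomial_maps.intros)

lemma polynomial_maps_finite_support:
  assumes "p \<in> polynomial_maps"
  shows "\<exists>V. finite V \<and> (\<forall>x y. (\<forall>v\<in>V. x v = y v) \<longrightarrow> p x = p y)"
  using assms
proof induction
  case (const c)
  then show ?case by (intro exI[of _ "{}"]) auto
next
  case (var v)
  then show ?case by (intro exI[of _ "{v}"]) auto
next
  case (add p q)
  then obtain V W where "finite V" "finite W"
    "\<forall>x y. (\<forall>v\<in>V. x v = y v) \<longrightarrow> p x = p y" "\<forall>x y. (\<forall>v\<in>W. x v = y v) \<longrightarrow> q x = q y" by auto
  then show ?case by (intro exI[of _ "V \<union> W"]) (metis UnI1 UnI2 finite_UnI)
next
  case (mult p q)
  then obtain V W where "finite V" "finite W"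
    "\<forall>x y. (\<forall>v\<in>V. x v = y v) \<longrightarrow> p x = p y" "\<forall>x y. (\<forall>v\<in>W. x v = y v) \<longrightarrow> q x = q y" by auto
  then show ?case by (intro exI[of _ "V \<union> W"]) (metis UnI1 UnI2 finite_UnI)
qed

inductive_set constructible :: "('v \<Rightarrow> 'a::field) set set" where
  zero: "p \<in> polynomial_maps \<Longrightarrow> {x. p x = 0} \<in> constructible"
| nonzero: "p \<in> polynomial_maps \<Longrightarrow> {x. p x \<noteq> 0} \<in> constructible"
| Un: "A \<in> constructible \<Longrightarrow> B \<in> constructible \<Longrightarrow> A \<union> B \<in> constructible"
| Int: "A \<in> constructible \<Longrightarrow> B \<in> constructible \<Longrightarrow> A \<inter> B \<in> constructible"

lemma constructible_empty: "{} \<in> constructible"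
  using constructible.zero[OF polynomial_maps.const[of 1]] by simp

lemma constructible_UNIV: "UNIV \<in> constructible"
  using constructible.zero[OF polynomial_maps.const[of 0]] by simp

lemma constructible_UN:
  "finite I \<Longrightarrow> (\<And>i. i \<in> I \<Longrightarrow> A i \<in> constructible) \<Longrightarrow> (\<Union>i\<in>I. A i) \<in> constructible"
  by (induction I rule: finite_induct) (auto intro: constructible_empty constructible.Un)

lemma constructible_ball:
  "finite I \<Longrightarrow> (\<And>i. i \<in> I \<Longrightarrow> {x. A i x} \<in> constructible) \<Longrightarrow> {x. \<forall>i\<in>I. A i x} \<in> constructible"
proof (induction I rule: finite_induct)
  case empty
  then show ?case using constructible_UNIV by simp
next
  case (insert i I)
  have "{x. \<forall>i\<in>insert i I. A i x} = {x. A i x} \<inter> {x. \<forall>i\<in>I. A i x}" by auto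
  then show ?case using insert by (auto intro: constructible.Int)
qed

lemma constructible_conj:
  "{x. A x} \<in> constructible \<Longrightarrow> {x. B x} \<in> constructible \<Longrightarrow> {x. A x \<and> B x} \<in> constructible"
  using constructible.Int[of "{x. A x}" "{x. B x}"] by (simp add: Int_def)

lemma constructible_eq:
  "p \<in> polynomial_maps \<Longrightarrow> q \<in> polynomial_maps \<Longrightarrow> {x. p x = q x} \<in> constructible"
  using constructible.zero[OF polynomial_maps_diff[of p q]] by simp

text \<open>The terms of a disjunctive normal form. A single inequation is enough, because finitely
  many inequations hold together exactly when the product is nonzero.\<close>

definition basic_sets :: "('v \<Rightarrow> 'a::field) set set" where
  "basic_sets = {{x. (\<forall>p\<in>Z. p x = 0) \<and> q x \<noteq> 0} | Z q. finite Z \<and> Z \<subseteq> polynomial_maps \<and> q \<in> polynomial_maps}"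

lemma basic_sets_Int:
  assumes "A \<in> basic_sets" "B \<in> basic_sets"
  shows "A \<inter> B \<in> basic_sets"
proof -
  from assms obtain Z q Z' q' where *: "A = {x. (\<forall>p\<in>Z. p x = 0) \<and> q x \<noteq> 0}" "finite Z"
      "Z \<subseteq> polynomial_maps" "q \<in> polynomial_maps" "B = {x. (\<forall>p\<in>Z'. p x = 0) \<and> q' x \<noteq> 0}"
      "finite Z'" "Z' \<subseteq> polynomial_maps" "q' \<in> polynomial_maps"
    unfolding basic_sets_def by auto
  show ?thesis unfolding basic_sets_def
    by (rule CollectI, rule exI[of _ "Z \<union> Z'"], rule exI[of _ "\<lambda>x. q x * q' x"])
      (use * in \<open>auto intro: polynomial_maps.mult\<close>)
qed

lemma constructible_finite_union:
  assumes "A \<in> constructible"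
  shows "\<exists>\<B>. finite \<B> \<and> \<B> \<subseteq> basic_sets \<and> A = \<Union>\<B>"
  using assms
proof induction
  case (zero p)
  have "{x. p x = 0} \<in> basic_sets"
    unfolding basic_sets_def
    by (rule CollectI, rule exI[of _ "{p}"], rule exI[of _ "\<lambda>_. 1"])
      (use zero in \<open>auto intro: polynomial_maps.const\<close>)
  then show ?case by (intro exI[of _ "{{x. p x = 0}}"]) auto
next
  case (nonzero p)
  have "{x. p x \<noteq> 0} \<in> basic_sets"
    unfolding basic_sets_def
    by (rule CollectI, rule exI[of _ "{}"], rule exI[of _ p]) (use nonzero in auto)
  then show ?case by (intro exI[of _ "{{x. p x \<noteq> 0}}"]) auto
next
  case (Un A B)
  then obtain S T where "finite S" "finite T" "S \<subseteq> basic_sets" "T \<subseteq> basic_sets"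
    "A = \<Union>S" "B = \<Union>T" by auto
  then show ?case by (intro exI[of _ "S \<union> T"]) auto
next
  case (Int A B)
  then obtain S T where *: "finite S" "finite T" "S \<subseteq> basic_sets" "T \<subseteq> basic_sets"
    "A = \<Union>S" "B = \<Union>T" by auto
  then show ?case
    by (intro exI[of _ "(\<lambda>(a,b). a \<inter> b) ` (S \<times> T)"]) (auto intro!: basic_sets_Int)
qed

section \<open>Univariate polynomials with parameters in the coefficients\<close>

text \<open>The coefficients lie in a ring of functions, which has zero divisors. A nonzero leading
  coefficient can vanish at some \<open>x\<close>, so the degree may drop under specialisation; this
  drop is the source of the later case distinctions.\<close>

definition specialise :: "('x \<Rightarrow> 'a::field) poly \<Rightarrow> 'x \<Rightarrow> 'a poly" where
  "specialise P x = map_poly (\<lambda>c. c x) P"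

lemma coeff_specialise: "coeff (specialise P x) n = coeff P n x"
  unfolding specialise_def by (subst coeff_map_poly) auto

lemma sum_fun_at: "(\<Sum>i\<in>I. f i) x = (\<Sum>i\<in>I. f i x)"
  by (induction I rule: infinite_finite_induct) auto

lemma specialise_add: "specialise (P + Q) x = specialise P x + specialise Q x"
  by (rule poly_eqI) (simp add: coeff_specialise)

lemma specialise_diff: "specialise (P - Q) x = specialise P x - specialise Q x"
  by (rule poly_eqI) (simp add: coeff_specialise fun_diff_def)

lemma specialise_mult: "specialise (P * Q) x = specialise P x * specialise Q x"
  by (rule poly_eqI) (simp add: coeff_specialise coeff_mult sum_fun_at)

lemma specialise_power: "specialise (P ^ n) x = specialise P x ^ n"
  by (induction n) (auto simp: specialise_mult intro!: poly_eqI simp: coeff_specialise)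

lemma specialise_smult: "specialise (Polynomial.smult c P) x = Polynomial.smult (c x) (specialise P x)"
  by (rule poly_eqI) (simp add: coeff_specialise)

lemma specialise_monom: "specialise (monom c n) x = monom (c x) n"
  by (rule poly_eqI) (simp add: coeff_specialise)

lemma specialise_0: "specialise 0 x = 0"
  by (rule poly_eqI) (simp add: coeff_specialise)

definition param_polys :: "(('v \<Rightarrow> 'a::field) \<Rightarrow> 'a) poly set" where
  "param_polys = {P. \<forall>n. coeff P n \<in> polynomial_maps}"

lemma polynomial_maps_fun:
  "0 \<in> polynomial_maps" "1 \<in> polynomial_maps"
  "p \<in> polynomial_maps \<Longrightarrow> q \<in> polynomial_maps \<Longrightarrow> p + q \<in> polynomial_maps"
  "p \<in> polynomial_maps \<Longrightarrow> q \<in> polynomial_maps \<Longrightarrow> p - q \<in> polynomial_maps"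
  "p \<in> polynomial_maps \<Longrightarrow> q \<in> polynomial_maps \<Longrightarrow> p * q \<in> polynomial_maps"
  unfolding zero_fun_def one_fun_def plus_fun_def times_fun_def fun_diff_def
  by (auto intro: polynomial_maps.intros polynomial_maps_diff)

lemma polynomial_maps_sum_fun:
  "(\<And>i. i \<in> I \<Longrightarrow> p i \<in> polynomial_maps) \<Longrightarrow> sum p I \<in> polynomial_maps"
  by (induction I rule: infinite_finite_induct) (auto intro: polynomial_maps_fun)

lemma param_polys_closed:
  "0 \<in> param_polys" "1 \<in> param_polys"
  "P \<in> param_polys \<Longrightarrow> Q \<in> param_polys \<Longrightarrow> P + Q \<in> param_polys"
  "P \<in> param_polys \<Longrightarrow> Q \<in> param_polys \<Longrightarrow> P - Q \<in> param_polys"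
  "P \<in> param_polys \<Longrightarrow> Q \<in> param_polys \<Longrightarrow> P * Q \<in> param_polys"
  "c \<in> polynomial_maps \<Longrightarrow> P \<in> param_polys \<Longrightarrow> Polynomial.smult c P \<in> param_polys"
  "c \<in> polynomial_maps \<Longrightarrow> monom c n \<in> param_polys"
  unfolding param_polys_def
  by (auto simp: coeff_mult coeff_1 intro: polynomial_maps_fun polynomial_maps_sum_fun)

lemma param_polys_power: "P \<in> param_polys \<Longrightarrow> P ^ n \<in> param_polys"
  by (induction n) (auto intro: param_polys_closed)

lemma lead_coeff_param_polys: "P \<in> param_polys \<Longrightarrow> lead_coeff P \<in> polynomial_maps"
  by (auto simp: param_polys_def)

lemma polynomial_maps_as_param_poly:
  assumes "p \<in> polynomial_maps"
  shows "\<exists>P\<in>param_polys. \<forall>x y. p (x(v := y)) = poly (specialise P x) y"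
  using assms
proof induction
  case (const c)
  show ?case
    by (rule bexI[of _ "monom (\<lambda>_. c) 0"])
      (auto simp: specialise_monom poly_monom intro: param_polys_closed polynomial_maps.const)
next
  case (var w)
  show ?case
  proof (cases "w = v")
    case True
    then show ?thesis
      by (intro bexI[of _ "monom (\<lambda>_. 1) 1"])
        (auto simp: specialise_monom poly_monom intro: param_polys_closed polynomial_maps.const)
  next
    case False
    then show ?thesis
      by (intro bexI[of _ "monom (\<lambda>x. x w) 0"])
        (auto simp: specialise_monom poly_monom intro: param_polys_closed polynomial_maps.var)
  qed
next
  case (add p q)
  then obtain P Q where "P \<in> param_polys" "Q \<in> param_polys"
    "\<forall>x y. p (x(v := y)) = poly (specialise P x) y" "\<forall>x y. q (x(v := y)) = poly (specialise Q x) y"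
    by blast
  then show ?case by (intro bexI[of _ "P + Q"]) (auto simp: specialise_add fun_upd_def intro: param_polys_closed)
next
  case (mult p q)
  then obtain P Q where "P \<in> param_polys" "Q \<in> param_polys"
    "\<forall>x y. p (x(v := y)) = poly (specialise P x) y" "\<forall>x y. q (x(v := y)) = poly (specialise Q x) y"
    by blast
  then show ?case by (intro bexI[of _ "P * Q"]) (auto simp: specialise_mult fun_upd_def intro: param_polys_closed)
qed

text \<open>Cross-multiplying by the leading coefficients avoids division, so this works over any
  commutative ring. The alternative \<open>R = 0\<close> covers constant \<open>Q\<close>, whose
  degree cannot decrease.\<close>

lemma cancel_lead_terms:
  fixes P Q :: "'r::comm_ring_1 poly"
  assumes "degree P \<le> degree Q"
  defines "R \<equiv> Polynomial.smult (lead_coeff P) Q - monom (lead_coeff Q) (degree Q - degree P) * P"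
  shows "R = 0 \<or> degree R < degree Q"
proof (rule ccontr)
  assume "\<not> ?thesis"
  then have R: "R \<noteq> 0" "degree Q \<le> degree R" by auto
  have "degree R \<le> degree Q"
    unfolding R_def
  proof (rule degree_diff_le)
    show "degree (Polynomial.smult (lead_coeff P) Q) \<le> degree Q" by (rule degree_smult_le)
    show "degree (monom (lead_coeff Q) (degree Q - degree P) * P) \<le> degree Q"
      using degree_mult_le[of "monom (lead_coeff Q) (degree Q - degree P)" P]
        degree_monom_le[of "lead_coeff Q" "degree Q - degree P"] assms(1) by linarith
  qed
  then have "degree R = degree Q" using R by simp
  moreover have "coeff R (degree Q) = 0"
    using assms(1) by (simp add: R_def coeff_monom_mult mult.commute[of _ "coeff P _"])
  ultimately show False using R(1) by (metis leading_coeff_0_iff)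
qed

lemma pseudo_division:
  fixes P Q :: "(('v \<Rightarrow> 'a::field) \<Rightarrow> 'a) poly"
  assumes "P \<in> param_polys" "Q \<in> param_polys"
  shows "\<exists>n A R. A \<in> param_polys \<and> R \<in> param_polys \<and> Polynomial.smult (lead_coeff P ^ n) Q = A * P + R
    \<and> (R = 0 \<or> degree R < degree P)"
  using assms(2)
\<comment> \<open>The zero polynomial gets a smaller measure than the constants: when
  \<open>P\<close> and \<open>Q\<close> are both constant, the reduction reaches 0 without lowering
  the degree.\<close>
proof (induction "if Q = 0 then 0 else Suc (degree Q)" arbitrary: Q rule: less_induct)
  case less
  show ?case
  proof (cases "Q = 0 \<or> degree Q < degree P")
    case True
    then show ?thesis
      using less.prems by (intro exI[of _ 0] exI[of _ 0] exI[of _ Q]) (auto intro: param_polys_closed)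
  next
    case False
    define B where "B = monom (lead_coeff Q) (degree Q - degree P)"
    define Q' where "Q' = Polynomial.smult (lead_coeff P) Q - B * P"
    have BP: "B \<in> param_polys" unfolding B_def
      by (intro param_polys_closed lead_coeff_param_polys less.prems)
    have Q'P: "Q' \<in> param_polys" unfolding Q'_def
      by (intro param_polys_closed BP lead_coeff_param_polys less.prems assms(1))
    have "Q' = 0 \<or> degree Q' < degree Q"
      unfolding Q'_def B_def by (rule cancel_lead_terms) (use False in auto)
    then have "(if Q' = 0 then 0 else Suc (degree Q')) < (if Q = 0 then 0 else Suc (degree Q))"
      using False by auto
    from less.hyps[OF this Q'P] obtain n A R where
      *: "A \<in> param_polys" "R \<in> param_polys" "Polynomial.smult (lead_coeff P ^ n) Q' = A * P + R"
        "R = 0 \<or> degree R < degree P" by blast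
    have "Polynomial.smult (lead_coeff P ^ Suc n) Q = Polynomial.smult (lead_coeff P ^ n) (Q' + B * P)"
      by (simp add: Q'_def mult.commute)
    also have "\<dots> = (A + Polynomial.smult (lead_coeff P ^ n) B) * P + R"
      by (simp add: smult_add_right *(3) algebra_simps)
    finally have eq: "Polynomial.smult (lead_coeff P ^ Suc n) Q = (A + Polynomial.smult (lead_coeff P ^ n) B) * P + R" .
    have "lead_coeff P ^ n \<in> polynomial_maps"
      using lead_coeff_param_polys[OF assms(1)] by (induction n) (auto intro: polynomial_maps_fun)
    then have "A + Polynomial.smult (lead_coeff P ^ n) B \<in> param_polys"
      by (intro param_polys_closed * BP)
    then show ?thesis using * eq by blast
  qed
qed

lemma fun_power_at: "(f ^ n) x = (f x :: 'a::comm_ring_1) ^ n"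
  by (induction n) auto

lemma specialise_eq_0_iff: "specialise R x = 0 \<longleftrightarrow> (\<forall>n\<le>degree R. coeff R n x = 0)"
proof
  assume *: "\<forall>n\<le>degree R. coeff R n x = 0"
  show "specialise R x = 0"
  proof (rule poly_eqI)
    show "coeff (specialise R x) n = coeff 0 n" for n
      using * coeff_eq_0[of R n] by (cases "n \<le> degree R") (auto simp: coeff_specialise)
  qed
qed (metis coeff_specialise coeff_0)

lemma constructible_specialise_nonzero:
  assumes "R \<in> param_polys"
  shows "{x. specialise R x \<noteq> 0} \<in> constructible"
proof -
  have "{x. specialise R x \<noteq> 0} = (\<Union>n\<in>{..degree R}. {x. coeff R n x \<noteq> 0})"
    by (auto simp: specialise_eq_0_iff)
  moreover have "\<dots> \<in> constructible"
    by (rule constructible_UN) (use assms in \<open>auto simp: param_polys_def intro: constructible.nonzero\<close>)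
  ultimately show ?thesis by simp
qed

section \<open>Elimination of one unknown\<close>

definition solvable_locus ::
  "('x \<Rightarrow> 'a::field) poly list \<Rightarrow> ('x \<Rightarrow> 'a) poly \<Rightarrow> 'x set" where
  "solvable_locus Ps Q =
    {x. \<exists>y. (\<forall>P\<in>set Ps. poly (specialise P x) y = 0) \<and> poly (specialise Q x) y \<noteq> 0}"

lemma solvable_locus_set_cong: "set Ps = set Ps' \<Longrightarrow> solvable_locus Ps Q = solvable_locus Ps' Q"
  unfolding solvable_locus_def by simp

text \<open>Where the leading coefficient is nonzero, \<open>specialise P x\<close> keeps its
  degree. It then has a root outside the zeros of \<open>specialise Q x\<close> exactly when it
  fails to divide the power \<open>degree P\<close> of the latter. By pseudo-division this says that
  the remainder \<open>R\<close> does not specialise to 0, a condition on its coefficients.\<close>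

lemma solvable_locus_single:
  fixes P Q :: "(('v \<Rightarrow> 'a::field) \<Rightarrow> 'a) poly"
  assumes ac: "algebraically_closed TYPE('a)" and P: "P \<in> param_polys" and Q: "Q \<in> param_polys"
  shows "solvable_locus [P] Q \<inter> {x. lead_coeff P x \<noteq> 0} \<in> constructible"
proof -
  obtain n A R where R: "R \<in> param_polys"
      "Polynomial.smult (lead_coeff P ^ n) (Q ^ degree P) = A * P + R" "R = 0 \<or> degree R < degree P"
    using pseudo_division[OF P param_polys_power[OF Q]] by metis
  have "x \<in> solvable_locus [P] Q \<longleftrightarrow> specialise R x \<noteq> 0" if lc: "lead_coeff P x \<noteq> 0" for x
  proof -
    define p q r c where "p = specialise P x" "q = specialise Q x" "r = specialise R x"
      "c = lead_coeff P x ^ n"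
    note defs = this
    have "degree p \<le> degree P"
      unfolding defs specialise_def by (rule map_poly_degree_leq)
    moreover have "coeff p (degree P) \<noteq> 0" using lc by (simp add: defs coeff_specialise)
    ultimately have deg: "degree p = degree P" by (meson antisym le_degree)
    have "p \<noteq> 0" using \<open>coeff p (degree P) \<noteq> 0\<close> by auto
    have "degree r \<le> degree R" unfolding defs specialise_def by (rule map_poly_degree_leq)
    then have r: "r = 0 \<or> degree r < degree p" using R(3) deg by (auto simp: defs specialise_0)
    have "c \<noteq> 0" using lc by (simp add: defs)
    have eq: "Polynomial.smult c (q ^ degree p) = specialise A x * p + r"
      using arg_cong[OF R(2), of "\<lambda>P. specialise P x"] deg
      by (simp add: defs specialise_add specialise_mult specialise_smult specialise_power fun_power_at)
    show ?thesis
    proof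
      assume "x \<in> solvable_locus [P] Q"
      then obtain y where y: "poly p y = 0" "poly q y \<noteq> 0" by (auto simp: solvable_locus_def defs)
      have "poly (Polynomial.smult c (q ^ degree p)) y \<noteq> 0" using y \<open>c \<noteq> 0\<close> by simp
      then show "specialise R x \<noteq> 0" unfolding eq using y by (auto simp: defs)
    next
      assume "specialise R x \<noteq> 0"
      show "x \<in> solvable_locus [P] Q"
      proof (rule ccontr)
        assume "x \<notin> solvable_locus [P] Q"
        then have "poly q y = 0" if "poly p y = 0" for y
          using that by (auto simp: solvable_locus_def defs)
        then have "p dvd q ^ degree p"
          using algebraically_closed_dvd_power[OF ac \<open>p \<noteq> 0\<close>] by blast
        then have "p dvd specialise A x * p + r" unfolding eq[symmetric] by (rule dvd_smult)
        then have "p dvd r" by (simp add: dvd_add_right_iff)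
        then show False using r \<open>specialise R x \<noteq> 0\<close> dvd_imp_degree_le[of p r]
          by (auto simp: defs)
      qed
    qed
  qed
  then have "solvable_locus [P] Q \<inter> {x. lead_coeff P x \<noteq> 0}
    = {x. specialise R x \<noteq> 0} \<inter> {x. lead_coeff P x \<noteq> 0}" by auto
  then show ?thesis
    using constructible_specialise_nonzero[OF R(1)] lead_coeff_param_polys[OF P]
    by (auto intro: constructible.Int constructible.nonzero)
qed

lemma degree_truncate:
  fixes P :: "'r::comm_ring_1 poly"
  assumes "P \<noteq> 0"
  shows "P - monom (lead_coeff P) (degree P) = 0 \<or> degree (P - monom (lead_coeff P) (degree P)) < degree P"
  using cancel_lead_terms[of 1 P] by simp

text \<open>The offsets make every step of the elimination strictly decreasing: deleting a zero
  polynomial saves 1, and truncating a nonzero constant to zero goes from 2 to 1.\<close>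

definition elimination_size :: "'r::zero poly \<Rightarrow> nat" where
  "elimination_size P = (if P = 0 then 1 else degree P + 2)"

text \<open>The Euclidean algorithm with a case distinction at each leading coefficient. While two
  polynomials remain, the one of larger degree is reduced by the other where the leading coefficient
  of that other is nonzero, and the other is truncated where it vanishes; at most one equation is
  left at the end.\<close>

lemma solvable_locus_constructible:
  fixes Ps :: "(('v \<Rightarrow> 'a::field) \<Rightarrow> 'a) poly list"
  assumes ac: "algebraically_closed TYPE('a)" and "set Ps \<subseteq> param_polys" and Q: "Q \<in> param_polys"
  shows "solvable_locus Ps Q \<in> constructible"
  using assms(2)
proof (induction "sum_list (map elimination_size Ps)" arbitrary: Ps rule: less_induct)
  case less
  text \<open>On the locus where the leading coefficient vanishes, the polynomial may be truncated.\<close>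
  have vanishing: "solvable_locus (P # Ps') Q \<inter> {x. lead_coeff P x = 0} \<in> constructible"
    if "mset Ps = mset (P # Ps')" "P \<noteq> 0" for P Ps'
  proof -
    define P' where "P' = P - monom (lead_coeff P) (degree P)"
    have P: "P \<in> param_polys" "set Ps' \<subseteq> param_polys"
      using less.prems mset_eq_setD[OF that(1)] by auto
    then have P': "P' \<in> param_polys"
      unfolding P'_def by (intro param_polys_closed lead_coeff_param_polys)
    have "solvable_locus (P # Ps') Q \<inter> {x. lead_coeff P x = 0}
      = solvable_locus (P' # Ps') Q \<inter> {x. lead_coeff P x = 0}"
      by (auto simp: solvable_locus_def P'_def specialise_diff specialise_monom)
    moreover have "elimination_size P' < elimination_size P"
      using degree_truncate[OF that(2)] that(2) by (auto simp: elimination_size_def P'_def)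
    then have "sum_list (map elimination_size (P' # Ps')) < sum_list (map elimination_size Ps)"
      using that(1) by (metis (mono_tags) add_less_cancel_right list.simps(9) mset_map sum_list.Cons sum_mset_sum_list)
    then have "solvable_locus (P' # Ps') Q \<in> constructible"
      by (rule less.hyps) (use P P' in auto)
    ultimately show ?thesis
      using lead_coeff_param_polys[OF P(1)] by (auto intro: constructible.Int constructible.zero)
  qed
  \<comment> \<open>As \<open>vanishing\<close> settles the complement, a chosen nonzero equation
    may be assumed to have a nonvanishing leading coefficient. Multisets allow any member of the
    list to be moved to the front.\<close>
  have split: "solvable_locus Ps Q \<in> constructible"
    if "solvable_locus (P # Ps') Q \<inter> {x. lead_coeff P x \<noteq> 0} \<in> constructible"
      "mset Ps = mset (P # Ps')" "P \<noteq> 0" for P Ps'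
  proof -
    have "solvable_locus Ps Q = solvable_locus (P # Ps') Q"
      by (rule solvable_locus_set_cong, rule mset_eq_setD, rule that(2))
    also have "\<dots> = (solvable_locus (P # Ps') Q \<inter> {x. lead_coeff P x = 0})
      \<union> (solvable_locus (P # Ps') Q \<inter> {x. lead_coeff P x \<noteq> 0})" by auto
    finally show ?thesis using vanishing[OF that(2,3)] that(1) by (simp add: constructible.Un)
  qed
  show ?case
  proof (cases "0 \<in> set Ps")
    case True
    then obtain us vs where Ps: "Ps = us @ 0 # vs" by (auto dest: split_list)
    have "solvable_locus (us @ vs) Q \<in> constructible"
      by (rule less.hyps) (use less.prems Ps in \<open>auto simp: elimination_size_def\<close>)
    moreover have "solvable_locus (us @ vs) Q = solvable_locus Ps Q"
      unfolding solvable_locus_def Ps by (auto simp: specialise_0)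
    ultimately show ?thesis by simp
  next
    case nz: False
    consider "Ps = []" | P where "Ps = [P]" | P1 P2 Ps' where "Ps = P1 # P2 # Ps'"
      by (metis list.exhaust)
    then show ?thesis
    proof cases
      case 1
      \<comment> \<open>With no equation left, a nonzero polynomial has a nonroot because the field
        is infinite.\<close>
      have "\<exists>y. poly q y \<noteq> 0" if "q \<noteq> 0" for q :: "'a poly"
        using poly_roots_finite[OF that] algebraically_closed_infinite[OF ac]
        by (metis (mono_tags) UNIV_I finite_subset mem_Collect_eq subsetI)
      then have "(\<exists>y. poly q y \<noteq> 0) \<longleftrightarrow> q \<noteq> 0" for q :: "'a poly"
        by auto
      then have "solvable_locus Ps Q = {x. specialise Q x \<noteq> 0}"
        using 1 by (auto simp: solvable_locus_def)
      then show ?thesis using constructible_specialise_nonzero[OF Q] by simp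
    next
      case 2
      show ?thesis
        by (rule split[of P "[]"], rule solvable_locus_single[OF ac _ Q])
          (use 2 nz less.prems in auto)
    next
      case 3
      obtain A B where AB: "mset Ps = mset (A # B # Ps')" "degree A \<le> degree B"
      proof (cases "degree P1 \<le> degree P2")
        case True
        then show ?thesis using that[of P1 P2] 3 by simp
      next
        case False
        then show ?thesis using that[of P2 P1] 3 by (simp add: add_mset_commute)
      qed
      have set: "set Ps = set (A # B # Ps')" using AB(1) by (rule mset_eq_setD)
      have mem: "A \<in> param_polys" "B \<in> param_polys" "set Ps' \<subseteq> param_polys" "A \<noteq> 0" "B \<noteq> 0"
        using less.prems nz unfolding set by auto
      define R where "R = Polynomial.smult (lead_coeff A) B - monom (lead_coeff B) (degree B - degree A) * A"
      have R: "R \<in> param_polys"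
        unfolding R_def by (intro param_polys_closed lead_coeff_param_polys mem)
      have "R = 0 \<or> degree R < degree B" unfolding R_def by (rule cancel_lead_terms[OF AB(2)])
      then have "elimination_size R < elimination_size B"
        using mem by (auto simp: elimination_size_def)
      moreover have "sum_list (map elimination_size Ps) = sum_list (map elimination_size (A # B # Ps'))"
        using arg_cong[OF AB(1), of "\<lambda>m. sum_mset (image_mset elimination_size m)"]
        by (simp add: sum_mset_sum_list flip: mset_map)
      ultimately have "sum_list (map elimination_size (A # R # Ps')) < sum_list (map elimination_size Ps)"
        by simp
      then have "solvable_locus (A # R # Ps') Q \<in> constructible"
        by (rule less.hyps) (use mem R in auto)
      \<comment> \<open>Here \<open>R\<close> is a nonzero multiple of \<open>B\<close> minus a
        multiple of \<open>A\<close>, so the common zeros of \<open>A\<close> and \<open>B\<close>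
        are those of \<open>A\<close> and \<open>R\<close>.\<close>
      moreover have "solvable_locus (A # B # Ps') Q \<inter> {x. lead_coeff A x \<noteq> 0}
        = solvable_locus (A # R # Ps') Q \<inter> {x. lead_coeff A x \<noteq> 0}"
        by (auto simp: solvable_locus_def R_def specialise_diff specialise_mult specialise_smult)
      ultimately have "solvable_locus (A # B # Ps') Q \<inter> {x. lead_coeff A x \<noteq> 0} \<in> constructible"
        using lead_coeff_param_polys[OF mem(1)] by (auto intro: constructible.Int constructible.nonzero)
      then show ?thesis by (rule split) (use AB mem in auto)
    qed
  qed
qed

section \<open>Projections of constructible sets\<close>

text \<open>Chevalley's theorem for one coordinate. Existence commutes with finite unions, so a
  basic set may be taken; its conditions, read as polynomials in the coordinate \<open>v\<close>,
  form a system in one unknown. The projection is kept as a cylinder in the same space.\<close>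

lemma constructible_projection:
  fixes A :: "('v \<Rightarrow> 'a::field) set"
  assumes ac: "algebraically_closed TYPE('a)" and "A \<in> constructible"
  shows "{x. \<exists>y. x(v := y) \<in> A} \<in> constructible"
proof -
  obtain \<B> where B: "finite \<B>" "\<B> \<subseteq> basic_sets" "A = \<Union>\<B>"
    using constructible_finite_union[OF assms(2)] by blast
  have "{x. \<exists>y. x(v := y) \<in> S} \<in> constructible" if "S \<in> \<B>" for S
  proof -
    obtain Z q where S: "S = {x. (\<forall>p\<in>Z. p x = 0) \<and> q x \<noteq> 0}" "finite Z"
      "Z \<subseteq> polynomial_maps" "q \<in> polynomial_maps"
      using subsetD[OF B(2) \<open>S \<in> \<B>\<close>] unfolding basic_sets_def by auto
    define F where "F p = (SOME P. P \<in> param_polys \<and> (\<forall>x y. p (x(v := y)) = poly (specialise P x) y))"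
      for p :: "('v \<Rightarrow> 'a) \<Rightarrow> 'a"
    have F: "F p \<in> param_polys \<and> (\<forall>x y. p (x(v := y)) = poly (specialise (F p) x) y)"
      if "p \<in> polynomial_maps" for p
      unfolding F_def by (rule someI_ex) (use polynomial_maps_as_param_poly[OF that, of v] in blast)
    obtain zs where zs: "set zs = Z" using S(2) finite_list by blast
    have "{x. \<exists>y. x(v := y) \<in> S} = solvable_locus (map F zs) (F q)"
      unfolding S(1) solvable_locus_def using S(3,4) F zs
      by (simp del: fun_upd_apply add: subset_iff)
    then show ?thesis
      using solvable_locus_constructible[OF ac, of "map F zs" "F q"] F S(3,4) zs by auto
  qed
  then have "(\<Union>S\<in>\<B>. {x. \<exists>y. x(v := y) \<in> S}) \<in> constructible"
    by (rule constructible_UN[OF B(1)])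
  moreover have "(\<Union>S\<in>\<B>. {x. \<exists>y. x(v := y) \<in> S}) = {x. \<exists>y. x(v := y) \<in> A}"
    using B(3) by auto
  ultimately show ?thesis by simp
qed

lemma constructible_finite_support:
  assumes "A \<in> constructible"
  shows "\<exists>V. finite V \<and> (\<forall>x y. (\<forall>v\<in>V. x v = y v) \<longrightarrow> x \<in> A \<longrightarrow> y \<in> A)"
  using assms
proof induction
  case (zero p)
  then show ?case using polynomial_maps_finite_support[OF zero] by (metis mem_Collect_eq)
next
  case (nonzero p)
  then show ?case using polynomial_maps_finite_support[OF nonzero] by (metis mem_Collect_eq)
next
  case (Un A B)
  then obtain V W where "finite V" "finite W"
    "\<forall>x y. (\<forall>v\<in>V. x v = y v) \<longrightarrow> x \<in> A \<longrightarrow> y \<in> A"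
    "\<forall>x y. (\<forall>v\<in>W. x v = y v) \<longrightarrow> x \<in> B \<longrightarrow> y \<in> B" by auto
  then show ?case by (intro exI[of _ "V \<union> W"]) blast
next
  case (Int A B)
  then obtain V W where "finite V" "finite W"
    "\<forall>x y. (\<forall>v\<in>V. x v = y v) \<longrightarrow> x \<in> A \<longrightarrow> y \<in> A"
    "\<forall>x y. (\<forall>v\<in>W. x v = y v) \<longrightarrow> x \<in> B \<longrightarrow> y \<in> B" by auto
  then show ?case by (intro exI[of _ "V \<union> W"]) blast
qed

lemma constructible_projection_finite:
  fixes A :: "('v \<Rightarrow> 'a::field) set"
  assumes ac: "algebraically_closed TYPE('a)" and "A \<in> constructible" and "finite V"
  shows "{x. \<exists>y. (\<lambda>v. if v \<in> V then y v else x v) \<in> A} \<in> constructible"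
  using assms(3)
proof (induction V rule: finite_induct)
  case empty
  then show ?case using assms(2) by simp
next
  case (insert w V)
  have "(\<exists>y. (\<lambda>v. if v \<in> insert w V then y v else x v) \<in> A) \<longleftrightarrow>
     (\<exists>z. x(w := z) \<in> {x. \<exists>y. (\<lambda>v. if v \<in> V then y v else x v) \<in> A})" (is "?l \<longleftrightarrow> ?r") for x
  proof
    assume ?l
    then obtain y where "(\<lambda>v. if v \<in> insert w V then y v else x v) \<in> A" ..
    moreover have "(\<lambda>v. if v \<in> insert w V then y v else x v)
      = (\<lambda>v. if v \<in> V then y v else (x(w := y w)) v)" by auto
    ultimately show ?r by auto
  next
    assume ?r
    then obtain z y where "(\<lambda>v. if v \<in> V then y v else (x(w := z)) v) \<in> A" by blast
    moreover have "(\<lambda>v. if v \<in> V then y v else (x(w := z)) v)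
      = (\<lambda>v. if v \<in> insert w V then (y(w := z)) v else x v)" using insert(2) by auto
    ultimately show ?l by metis
  qed
  then show ?case using constructible_projection[OF ac insert.IH, of w] by simp
qed

text \<open>The set \<open>W\<close> may be infinite, but membership in \<open>A\<close> depends on
  finitely many variables \<open>V\<close>, so quantifying over those in \<open>V \<inter> W\<close>
  has the same effect.\<close>

lemma constructible_projection_set:
  fixes A :: "('v \<Rightarrow> 'a::field) set"
  assumes ac: "algebraically_closed TYPE('a)" and A: "A \<in> constructible"
  shows "{x. \<exists>y. (\<lambda>v. if v \<in> W then y v else x v) \<in> A} \<in> constructible"
proof -
  obtain V where V: "finite V" "\<And>x y. (\<forall>v\<in>V. x v = y v) \<Longrightarrow> x \<in> A \<Longrightarrow> y \<in> A"
    using constructible_finite_support[OF A] by metis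
  have "(\<lambda>v. if v \<in> W then y v else x v) \<in> A \<longleftrightarrow> (\<lambda>v. if v \<in> V \<inter> W then y v else x v) \<in> A" for x y
    by (rule iffI; erule V(2)[rotated]) auto
  then have "{x. \<exists>y. (\<lambda>v. if v \<in> W then y v else x v) \<in> A}
    = {x. \<exists>y. (\<lambda>v. if v \<in> V \<inter> W then y v else x v) \<in> A}" by simp
  then show ?thesis using constructible_projection_finite[OF ac A, of "V \<inter> W"] V(1) by simp
qed

section \<open>Dimensions of subspaces\<close>

context vector_space
begin

text \<open>The ambient space may be infinite-dimensional, and \<open>dim\<close> is 0 on
  infinite-dimensional subspaces; the finite spanning set \<open>T\<close> excludes this.\<close>

lemma dim_mono_finite:
  assumes "finite T" "B \<subseteq> span T" "A \<subseteq> span B"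
  shows "dim A \<le> dim B"
proof -
  obtain D where D: "D \<subseteq> B" "independent D" "B \<subseteq> span D" "card D = dim B"
    by (rule basis_exists)
  have "finite D" using independent_span_bound[OF assms(1) D(2)] D(1) assms(2) by blast
  moreover have "A \<subseteq> span D"
    using assms(3) span_minimal[OF D(3) subspace_span] by blast
  ultimately have "dim A \<le> card D" by (intro dim_le_card)
  with D(4) show ?thesis by simp
qed

lemma dim_zero: "dim {0} = 0"
  using dim_eq_card[OF _ independent_empty, of "{0}"] by simp

lemma independent_Un_direct:
  assumes "finite F" "independent D" "independent F" "span D \<inter> span F = {0}"
  shows "independent (D \<union> F)"
  using assms(1,3,4)
proof (induction F rule: finite_induct)
  case empty
  then show ?case using assms(2) by simp
next
  case (insert f F)
  have F: "independent F" "f \<notin> span F"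
    using insert.prems(1) insert.hyps by (auto simp: independent_insert)
  have "span F \<subseteq> span (insert f F)" by (rule span_mono) auto
  then have *: "span D \<inter> span F = {0}" using insert.prems(2) span_zero by blast
  have "f \<notin> span (D \<union> F)"
  proof
    assume "f \<in> span (D \<union> F)"
    then obtain x y where xy: "f = x + y" "x \<in> span D" "y \<in> span F" by (auto simp: span_Un)
    have "f - y \<in> span (insert f F)"
      using xy(3) \<open>span F \<subseteq> span (insert f F)\<close> by (auto intro: span_diff span_base)
    moreover have "f - y = x" using xy by simp
    ultimately have "x = 0" using xy(2) insert.prems(2) by auto
    then show False using xy F by simp
  qed
  then show ?case using insert.IH[OF F(1) *] by (simp add: independent_insertI)
qed

lemma independent_span_Int:
  assumes "independent (C \<union> F)" "C \<inter> F = {}"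
  shows "span C \<inter> span F = {0}"
proof -
  have "z = 0" if z: "z \<in> span C" "z \<in> span F" for z
  proof -
    let ?R = "representation (C \<union> F) z"
    have "?R = representation C z" "?R = representation F z"
      using z by (auto intro!: representation_extend assms(1))
    then have "?R b = 0" for b
      using representation_ne_zero[of C z b] representation_ne_zero[of F z b] assms(2) by auto
    moreover have "z \<in> span (C \<union> F)" using z span_mono[of C "C \<union> F"] by auto
    ultimately show "z = 0" using sum_nonzero_representation_eq[OF assms(1), of z] by simp
  qed
  then show ?thesis using span_zero by auto
qed

text \<open>Grassmann's formula. Extend a basis \<open>C\<close> of the intersection to a basis
  \<open>E\<close> of \<open>B\<close>; the added part \<open>F\<close> spans a complement of
  \<open>A\<close> in the sum. Hence any basis \<open>D\<close> of \<open>A\<close>, whether or not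
  it contains \<open>C\<close>, becomes a basis of the sum when joined with
  \<open>F\<close>.\<close>

lemma dim_sum_Int_finite:
  assumes "finite T" "subspace A" "subspace B" "A \<subseteq> span T" "B \<subseteq> span T"
  shows "dim {x + y |x y. x \<in> A \<and> y \<in> B} + dim (A \<inter> B) = dim A + dim B"
proof -
  obtain C where C: "C \<subseteq> A \<inter> B" "independent C" "A \<inter> B \<subseteq> span C" "card C = dim (A \<inter> B)"
    by (rule basis_exists)
  obtain E where E: "C \<subseteq> E" "E \<subseteq> B" "independent E" "B \<subseteq> span E"
    using maximal_independent_subset_extend[of C B] C by blast
  obtain D where D: "D \<subseteq> A" "independent D" "A \<subseteq> span D" "card D = dim A"
    by (rule basis_exists)
  have fin: "finite D" "finite E"
    using independent_span_bound[OF assms(1)] D E assms by (metis subset_trans)+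
  define F where "F = E - C"
  have CF: "C \<union> F = E" "C \<inter> F = {}" using E by (auto simp: F_def)
  have spans: "span D = A" "span E = B"
    using D E assms(2,3) by (metis span_subspace)+
  have "span F \<subseteq> B" using spans(2) CF(1) span_mono[of F E] by blast
  have zero: "span D \<inter> span F = {0}"
  proof -
    have "span D \<inter> span F \<subseteq> span C \<inter> span F"
      using spans \<open>span F \<subseteq> B\<close> C(3) by blast
    also have "\<dots> = {0}" by (rule independent_span_Int) (use E(3) CF in auto)
    finally show ?thesis using span_zero by blast
  qed
  have ind: "independent (D \<union> F)"
    by (rule independent_Un_direct)
      (use fin D(2) independent_mono[OF E(3)] zero in \<open>auto simp: F_def\<close>)
  have "D \<inter> F \<subseteq> {0}" using zero span_base by blast
  moreover have "0 \<notin> D" using D(2) dependent_zero by blast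
  ultimately have "D \<inter> F = {}" by blast
  have "{x + y |x y. x \<in> A \<and> y \<in> B} = span (D \<union> E)" by (simp add: span_Un spans)
  also have "\<dots> = span (D \<union> F)"
  proof (rule antisym)
    have "C \<subseteq> span D" using C(1) spans by auto
    moreover have "span D \<subseteq> span (D \<union> F)" by (rule span_mono) auto
    ultimately have "D \<union> E \<subseteq> span (D \<union> F)" using CF span_superset[of "D \<union> F"] by blast
    then show "span (D \<union> E) \<subseteq> span (D \<union> F)" by (rule span_minimal) auto
    show "span (D \<union> F) \<subseteq> span (D \<union> E)" by (rule span_mono) (auto simp: F_def)
  qed
  finally have "dim {x + y |x y. x \<in> A \<and> y \<in> B} = card (D \<union> F)"
    using ind by (simp add: dim_eq_card_independent)
  also have "\<dots> = card D + card F"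
    using fin \<open>D \<inter> F = {}\<close> by (intro card_Un_disjoint) (auto simp: F_def)
  finally have "dim {x + y |x y. x \<in> A \<and> y \<in> B} = card D + card F" .
  moreover have "card E = card C + card F"
    using fin CF by (metis card_Un_disjoint finite_Un)
  moreover have "card E = dim B" using E by (intro basis_card_eq_dim) auto
  ultimately show ?thesis using C(4) D(4) by simp
qed

end

lemma (in vector_space_pair) dim_image_inj:
  assumes "Vector_Spaces.linear s1 s2 f" "inj_on f A" "vs1.subspace A"
  shows "vs2.dim (f ` A) = vs1.dim A"
proof -
  interpret Vector_Spaces.linear s1 s2 f by fact
  obtain B where B: "B \<subseteq> A" "vs1.independent B" "A \<subseteq> vs1.span B" "card B = vs1.dim A"
    by (rule vs1.basis_exists)
  have span: "vs1.span B = A" using B assms(3) by (intro vs1.span_subspace)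
  have "vs2.independent (f ` B)"
    by (rule independent_injective_image) (use B(2) assms(2) span in simp_all)
  moreover have "vs2.span (f ` B) = f ` A" using span_image[of B] span by simp
  ultimately have "vs2.dim (f ` A) = card (f ` B)"
    by (metis vs2.dim_span vs2.dim_eq_card_independent)
  also have "\<dots> = card B" using assms(2) B(1) by (intro card_image) (rule inj_on_subset)
  finally show ?thesis using B(4) by simp
qed

section \<open>Functions on the group as a vector space\<close>

definition gscale :: "'a::field \<Rightarrow> ('g \<Rightarrow> 'a) \<Rightarrow> ('g \<Rightarrow> 'a)" where
  "gscale c f = (\<lambda>x. c * f x)"

interpretation G: vector_space gscale
  by unfold_locales (auto simp: gscale_def fun_eq_iff algebra_simps)

interpretation S: vector_space fscale
  by unfold_locales (auto simp: fscale_def fun_eq_iff algebra_simps)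

interpretation GS: vector_space_pair gscale fscale
  by unfold_locales

lemma vector_space_pair_field: "vector_space_pair gscale ((*) :: 'a::field \<Rightarrow> 'a \<Rightarrow> 'a)"
  by unfold_locales (auto simp: algebra_simps)

definition delta :: "'g \<Rightarrow> 'g \<Rightarrow> 'a::field" where
  "delta y = (\<lambda>x. if x = y then 1 else 0)"

lemma supported_eq_sum_delta:
  assumes "finite C" "\<And>x. x \<notin> C \<Longrightarrow> a x = 0"
  shows "a = (\<Sum>y\<in>C. gscale (a y) (delta y))"
proof
  fix x
  have "(\<Sum>y\<in>C. gscale (a y) (delta y)) x = (\<Sum>y\<in>C. if y = x then a y else 0)"
    by (auto simp: sum_fun_at gscale_def delta_def intro!: sum.cong)
  also have "\<dots> = a x" using assms by (simp add: sum.delta)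
  finally show "a x = (\<Sum>y\<in>C. gscale (a y) (delta y)) x" by simp
qed

lemma supported_in_span:
  assumes "finite C" "\<And>x. x \<notin> C \<Longrightarrow> a x = 0"
  shows "a \<in> G.span (delta ` C)"
proof -
  have "(\<Sum>y\<in>C. gscale (a y) (delta y)) \<in> G.span (delta ` C)"
    by (intro G.span_sum G.span_scale G.span_base) auto
  then show ?thesis using supported_eq_sum_delta[OF assms] by simp
qed

text \<open>Pairing a linear relation with \<open>b' l\<close> leaves only its \<open>l\<close>-th
  coefficient, so the family is independent; the same pairing shows that \<open>b\<close> has no
  repetitions.\<close>

lemma dual_family_dim:
  assumes "\<And>j l. j < n \<Longrightarrow> l < n \<Longrightarrow> (\<Sum>x\<in>C. b' j x * b l x) = (if j = l then 1 else (0::'a::field))"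
  shows "G.dim (G.span (b ` {..<n})) = n"
proof -
  have inj: "inj_on b {..<n}"
  proof (rule inj_onI)
    fix j l assume "j \<in> {..<n}" "l \<in> {..<n}" "b j = b l"
    then show "j = l" using assms[of j l] assms[of j j] by (auto split: if_splits)
  qed
  have "G.independent (b ` {..<n})"
  proof (rule G.independent_if_scalars_zero)
    fix f x assume *: "(\<Sum>x\<in>b ` {..<n}. gscale (f x) x) = 0" and "x \<in> b ` {..<n}"
    then obtain l where l: "l < n" "x = b l" by auto
    have "(\<Sum>j<n. gscale (f (b j)) (b j)) = 0" using * inj by (simp add: sum.reindex)
    then have "(\<Sum>j<n. f (b j) * b j x) = 0" for x
      by (metis (no_types, lifting) gscale_def sum.cong sum_fun_at zero_fun_apply)
    then have "0 = (\<Sum>x\<in>C. b' l x * (\<Sum>j<n. f (b j) * b j x))" by simp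
    also have "\<dots> = (\<Sum>x\<in>C. \<Sum>j<n. f (b j) * (b' l x * b j x))"
      by (simp add: sum_distrib_left mult.left_commute)
    also have "\<dots> = (\<Sum>j<n. \<Sum>x\<in>C. f (b j) * (b' l x * b j x))"
      by (rule sum.swap)
    also have "\<dots> = (\<Sum>j<n. f (b j) * (\<Sum>x\<in>C. b' l x * b j x))"
      by (simp only: sum_distrib_left)
    also have "\<dots> = (\<Sum>j<n. if l = j then f (b j) else 0)"
      using l assms by (intro sum.cong) auto
    also have "\<dots> = f x" using l by simp
    finally show "f x = 0" by simp
  qed simp
  then show ?thesis
    by (simp add: G.dim_eq_card_independent card_image[OF inj])
qed

text \<open>The coordinate functionals of a basis of \<open>A\<close> extend linearly to the whole
  function space, and \<open>b' j\<close> lists the values of the \<open>j\<close>-th one on the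
  vectors \<open>delta\<close>. Independence thus becomes solvability of polynomial equations, with
  no rank condition.\<close>

lemma dual_basis_exists:
  fixes A :: "('g \<Rightarrow> 'a::field) set"
  assumes "finite C" "\<And>a x. a \<in> A \<Longrightarrow> x \<notin> C \<Longrightarrow> a x = 0"
  obtains b b' where "\<And>j. j < G.dim A \<Longrightarrow> b j \<in> A"
    "\<And>w. w \<in> A \<Longrightarrow> \<exists>c. \<forall>x. w x = (\<Sum>j<G.dim A. c j * b j x)"
    "\<And>j l. j < G.dim A \<Longrightarrow> l < G.dim A \<Longrightarrow>
      (\<Sum>x\<in>C. b' j x * b l x) = (if j = l then 1 else 0)"
proof -
  obtain B where B: "B \<subseteq> A" "G.independent B" "A \<subseteq> G.span B" "card B = G.dim A"
    by (rule G.basis_exists)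
  have "A \<subseteq> G.span (delta ` C)" using assms supported_in_span by blast
  then have "finite B"
    using G.independent_span_bound[of "delta ` C" B] B assms(1) by auto
  then obtain b where b: "bij_betw b {..<G.dim A} B"
    using ex_bij_betw_nat_finite[of B] B(4) by (auto simp: atLeast0LessThan)
  have "\<exists>f. Vector_Spaces.linear gscale (*) f \<and> (\<forall>l<G.dim A. f (b l) = (if j = l then 1 else 0))"
    if "j < G.dim A" for j
  proof -
    obtain f where f: "Vector_Spaces.linear gscale (*) f"
      "\<forall>x\<in>B. f x = (if x = b j then 1 else 0)"
      using vector_space_pair.linear_independent_extend[OF vector_space_pair_field B(2), of "\<lambda>x. if x = b j then 1 else 0"] by blast
    have "f (b l) = (if j = l then 1 else 0)" if "l < G.dim A" for l
      using f(2) b that \<open>j < G.dim A\<close> by (auto simp: bij_betw_def inj_on_def)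
    with f show ?thesis by blast
  qed
  then obtain f where f: "\<And>j. j < G.dim A \<Longrightarrow> Vector_Spaces.linear gscale (*) (f j)"
    "\<And>j l. j < G.dim A \<Longrightarrow> l < G.dim A \<Longrightarrow> f j (b l) = (if j = l then 1 else 0)"
    by metis
  show ?thesis
  proof (rule that[of b "\<lambda>j x. f j (delta x)"])
    show bA: "b j \<in> A" if "j < G.dim A" for j using b B(1) that by (auto simp: bij_betw_def)
    show "\<exists>c. \<forall>x. w x = (\<Sum>j<G.dim A. c j * b j x)" if "w \<in> A" for w
    proof -
      have "w \<in> G.span B" using that B(3) by auto
      then obtain u where "w = (\<Sum>v\<in>B. gscale (u v) v)" using G.span_finite[OF \<open>finite B\<close>] by auto
      also have "\<dots> = (\<Sum>j<G.dim A. gscale (u (b j)) (b j))"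
        by (rule sum.reindex_bij_betw[OF b, symmetric])
      finally show ?thesis
        by (intro exI[of _ "\<lambda>j. u (b j)"]) (simp add: sum_fun_at gscale_def)
    qed
    fix j l assume jl: "j < G.dim A" "l < G.dim A"
    interpret f: Vector_Spaces.linear gscale "(*)" "f j" by (rule f(1)) fact
    have "f j (b l) = f j (\<Sum>y\<in>C. gscale (b l y) (delta y))"
      using supported_eq_sum_delta[OF assms(1), of "b l"] assms(2) bA jl by simp
    also have "\<dots> = (\<Sum>x\<in>C. f j (delta x) * b l x)"
      by (simp add: f.sum f.scale mult.commute)
    finally show "(\<Sum>x\<in>C. f j (delta x) * b l x) = (if j = l then 1 else 0)"
      using f(2) jl by simp
  qed
qed

section \<open>Excess of subsheaves\<close>

lemma linear_place: "Vector_Spaces.linear gscale fscale (place v)"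
  by unfold_locales (auto simp: place_def gscale_def fscale_def fun_eq_iff)

lemma module_hom_place: "module_hom gscale fscale (place v)"
  by (rule linear_place[unfolded Vector_Spaces.linear_def, THEN conjunct2, THEN conjunct2])

lemma subspace_sheaf_V:
  assumes "\<And>v. v \<in> V \<Longrightarrow> G.subspace (A v)"
  shows "S.subspace (sheaf_V V A)"
proof (rule S.subspaceI)
  show "0 \<in> sheaf_V V A" using assms by (auto simp: sheaf_V_def G.subspace_0)
  show "f + g \<in> sheaf_V V A" if "f \<in> sheaf_V V A" "g \<in> sheaf_V V A" for f g
    using that assms by (auto simp: sheaf_V_def G.subspace_add)
  show "fscale c f \<in> sheaf_V V A" if "f \<in> sheaf_V V A" for c f
  proof -
    have "fscale c f v = gscale c (f v)" for v by (simp add: fscale_def gscale_def)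
    then show ?thesis using that assms by (auto simp: sheaf_V_def G.subspace_scale)
  qed
qed

lemma sheaf_V_finite_span:
  assumes "finite V" "finite C"
  shows "\<exists>T. finite T \<and> sheaf_V V (\<lambda>_. {a. \<forall>x. x \<notin> C \<longrightarrow> a x = (0::'a::field)}) \<subseteq> S.span T"
  using assms(1)
proof (induction V rule: finite_induct)
  case empty
  show ?case by (intro exI[of _ "{}"]) (auto simp: sheaf_V_def)
next
  case (insert v V)
  from insert.IH obtain T where
    T: "finite T" "sheaf_V V (\<lambda>_. {a. \<forall>x. x \<notin> C \<longrightarrow> a x = (0::'a)}) \<subseteq> S.span T"
    by auto
  have "f \<in> S.span (T \<union> place v ` delta ` C)"
    if f: "f \<in> sheaf_V (insert v V) (\<lambda>_. {a. \<forall>x. x \<notin> C \<longrightarrow> a x = (0::'a)})" for f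
  proof -
    have "f v \<in> G.span (delta ` C)"
      by (rule supported_in_span[OF assms(2)]) (use f in \<open>auto simp: sheaf_V_def\<close>)
    then have 1: "place v (f v) \<in> S.span (place v ` delta ` C)"
      unfolding module_hom.span_image[OF module_hom_place] by (rule imageI)
    have "f(v := 0) \<in> sheaf_V V (\<lambda>_. {a. \<forall>x. x \<notin> C \<longrightarrow> a x = (0::'a)})"
      using f insert(2) by (auto simp: sheaf_V_def)
    then have 2: "f(v := 0) \<in> S.span T" using T(2) by blast
    have "f = f(v := 0) + place v (f v)" by (auto simp: place_def fun_eq_iff)
    moreover have "f(v := 0) + place v (f v) \<in> S.span (T \<union> place v ` delta ` C)"
      using 1 2 S.span_mono[of T "T \<union> place v ` delta ` C"]
        S.span_mono[of "place v ` delta ` C" "T \<union> place v ` delta ` C"]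
      by (intro S.span_add) auto
    ultimately show ?thesis by simp
  qed
  then show ?case
    using T(1) assms(2) by (intro exI[of _ "T \<union> place v ` delta ` C"]) auto
qed

text \<open>Indices are added one at a time. The stalk placed at the new index meets the earlier sum
  in 0, so Grassmann's formula adds the dimensions. The index set is arbitrary since the result
  serves for vertices and for edges.\<close>

lemma dim_sheaf_V:
  fixes A :: "'v \<Rightarrow> ('g \<Rightarrow> 'a::field) set"
  assumes "finite V" "finite C"
    and "\<And>v. v \<in> V \<Longrightarrow> G.subspace (A v)"
    and "\<And>v a x. v \<in> V \<Longrightarrow> a \<in> A v \<Longrightarrow> x \<notin> C \<Longrightarrow> a x = 0"
  shows "S.dim (sheaf_V V A) = (\<Sum>v\<in>V. G.dim (A v))"
  using assms(1,3,4)
proof (induction V rule: finite_induct)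
  case empty
  have "sheaf_V {} A = {0}" by (auto simp: sheaf_V_def)
  then show ?case by (simp add: S.dim_zero)
next
  case (insert v V)
  obtain T where T: "finite T"
    "sheaf_V (insert v V) (\<lambda>_. {a. \<forall>x. x \<notin> C \<longrightarrow> a x = (0::'a)}) \<subseteq> S.span T"
    using sheaf_V_finite_span[of "insert v V" C] insert(1) assms(2) by auto
  have sub: "sheaf_V V A \<subseteq> sheaf_V (insert v V) A"
    using insert.prems(1) insert(2) by (auto simp: sheaf_V_def zero_fun_def[symmetric] G.subspace_0)
  have sub': "place v ` A v \<subseteq> sheaf_V (insert v V) A"
    using insert.prems(1) by (auto simp: sheaf_V_def place_def G.subspace_0)
  have sup: "sheaf_V (insert v V) A \<subseteq> S.span T"
    using T(2) insert.prems(2) unfolding sheaf_V_def by blast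
  have sum: "sheaf_V (insert v V) A = {x + y |x y. x \<in> sheaf_V V A \<and> y \<in> place v ` A v}"
  proof (rule antisym)
    have "S.subspace (sheaf_V (insert v V) A)"
      by (intro subspace_sheaf_V insert.prems)
    show "{x + y |x y. x \<in> sheaf_V V A \<and> y \<in> place v ` A v} \<subseteq> sheaf_V (insert v V) A"
      using sub sub' S.subspace_add[OF \<open>S.subspace (sheaf_V (insert v V) A)\<close>] by blast
    show "sheaf_V (insert v V) A \<subseteq> {x + y |x y. x \<in> sheaf_V V A \<and> y \<in> place v ` A v}"
    proof
      fix f assume f: "f \<in> sheaf_V (insert v V) A"
      have "f = f(v := 0) + place v (f v)" by (auto simp: place_def fun_eq_iff)
      moreover have "f(v := 0) \<in> sheaf_V V A" "f v \<in> A v"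
        using f insert(2) by (auto simp: sheaf_V_def)
      ultimately show "f \<in> {x + y |x y. x \<in> sheaf_V V A \<and> y \<in> place v ` A v}" by blast
    qed
  qed
  have int: "sheaf_V V A \<inter> place v ` A v = {0}"
  proof -
    have "place v w = 0" if "place v w \<in> sheaf_V V A" for w
    proof -
      have "place v w v = 0" using that insert(2) by (auto simp: sheaf_V_def)
      then show ?thesis by (auto simp: place_def fun_eq_iff)
    qed
    moreover have "0 \<in> sheaf_V V A"
      using subspace_sheaf_V[of V A] insert.prems(1) S.subspace_0 by blast
    moreover have "0 \<in> place v ` A v"
      using insert.prems(1)[of v] by (intro image_eqI[of _ _ 0]) (auto simp: place_def G.subspace_0)
    ultimately show ?thesis by auto
  qed
  have "S.dim (sheaf_V (insert v V) A) + S.dim {0::'v \<Rightarrow> 'g \<Rightarrow> 'a}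
    = S.dim (sheaf_V V A) + S.dim (place v ` A v)"
    unfolding sum int[symmetric]
    by (rule S.dim_sum_Int_finite[OF T(1)])
      (use sub sub' sup insert.prems in \<open>auto intro!: subspace_sheaf_V
        module_hom.subspace_image[OF module_hom_place]\<close>)
  moreover have "S.dim {0::'v \<Rightarrow> 'g \<Rightarrow> 'a} = 0" by (simp add: S.dim_zero)
  moreover have "S.dim (place v ` A v) = G.dim (A v)"
    by (rule GS.dim_image_inj[OF linear_place])
      (use insert.prems in \<open>auto intro!: inj_onI simp: place_def dest: fun_cong[of _ _ v]\<close>)
  moreover have "S.dim (sheaf_V V A) = (\<Sum>v\<in>V. G.dim (A v))"
    by (rule insert.IH) (use insert.prems in blast)+
  ultimately show ?case using insert(1,2) by simp
qed

section \<open>Reduction of the maximum excess to subsheaves\<close>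

definition points :: "'v set \<Rightarrow> 'e set \<Rightarrow> ('v + 'e) set" where
  "points V E = Inl ` V \<union> Inr ` E"

text \<open>Stated for dimension vectors rather than sheaves, so that it also applies to a translate
  of such a vector.\<close>

definition excess :: "'v set \<Rightarrow> 'e set \<Rightarrow> ('v + 'e \<Rightarrow> nat) \<Rightarrow> int" where
  "excess V E d = (\<Sum>e\<in>E. int (d (Inr e))) - (\<Sum>v\<in>V. int (d (Inl v)))"

definition subsheaf ::
  "'v set \<Rightarrow> 'e set \<Rightarrow> ('e \<Rightarrow> 'v) \<Rightarrow> ('e \<Rightarrow> 'v) \<Rightarrow> ('v + 'e \<Rightarrow> ('g \<Rightarrow> 'a::field) set)
    \<Rightarrow> ('v + 'e \<Rightarrow> ('g \<Rightarrow> 'a) set) \<Rightarrow> bool" where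
  "subsheaf V E h t F A \<longleftrightarrow> (\<forall>P\<in>points V E. G.subspace (A P) \<and> A P \<subseteq> F P) \<and>
    (\<forall>e\<in>E. A (Inr e) \<subseteq> A (Inl (h e)) \<inter> A (Inl (t e)))"

locale finite_sheaf =
  fixes V :: "'v set" and E :: "'e set" and h t :: "'e \<Rightarrow> 'v" and C :: "'g set"
    and F :: "'v + 'e \<Rightarrow> ('g \<Rightarrow> 'a::field) set"
  assumes finite: "finite V" "finite E" "finite C"
    and ends: "e \<in> E \<Longrightarrow> h e \<in> V" "e \<in> E \<Longrightarrow> t e \<in> V"
    and subspace_F: "P \<in> points V E \<Longrightarrow> G.subspace (F P)"
    and support_F: "P \<in> points V E \<Longrightarrow> a \<in> F P \<Longrightarrow> x \<notin> C \<Longrightarrow> a x = 0"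
begin

abbreviation "sub \<equiv> subsheaf V E h t F"
abbreviation "ex A \<equiv> excess V E (\<lambda>P. G.dim (A P))"
abbreviation "me \<equiv> max_excess V E h t (\<lambda>v. F (Inl v)) (\<lambda>e. F (Inr e))"

lemma finite_points: "finite (points V E)"
  using finite by (simp add: points_def)

lemma points_simps [simp]: "Inl v \<in> points V E \<longleftrightarrow> v \<in> V" "Inr e \<in> points V E \<longleftrightarrow> e \<in> E"
  by (auto simp: points_def)

lemma sub_support:
  assumes "sub A" "P \<in> points V E" "a \<in> A P" "x \<notin> C"
  shows "a x = 0"
proof -
  have "a \<in> F P" using assms by (auto simp: subsheaf_def)
  then show ?thesis using support_F assms by blast
qed

lemma sub_span: assumes "sub A" "P \<in> points V E" shows "A P \<subseteq> G.span (delta ` C)"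
  by (rule subsetI, rule supported_in_span[OF finite(3)], rule sub_support[OF assms])

lemma sub_subspace: "sub A \<Longrightarrow> P \<in> points V E \<Longrightarrow> G.subspace (A P)"
  unfolding subsheaf_def by blast

lemma sub_dim_le: assumes "sub A" "P \<in> points V E" shows "G.dim (A P) \<le> card C"
  using G.dim_le_card[OF sub_span[OF assms]] card_image_le[OF finite(3), of delta] finite(3)
  by (meson finite_imageI le_trans)

definition excess_set :: "int set" where
  "excess_set = {int (S.dim (Gamma_ht E h t (\<lambda>e. F (Inr e)) U)) - int (S.dim U)
    | U. S.subspace U \<and> U \<subseteq> sheaf_V V (\<lambda>v. F (Inl v))}"

lemma me_eq: "me = Max excess_set"
  unfolding max_excess_def excess_set_def ..

text \<open>The vertex stalks consist of the vectors of \<open>U\<close> concentrated at one vertex.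
  These are all that \<open>Gamma_ht\<close> can see of \<open>U\<close>, so the edge stalks sum to
  exactly \<open>Gamma_ht\<close> of \<open>U\<close>.\<close>

definition induced :: "('v \<Rightarrow> 'g \<Rightarrow> 'a) set \<Rightarrow> 'v + 'e \<Rightarrow> ('g \<Rightarrow> 'a) set" where
  "induced U P = (case P of Inl v \<Rightarrow> {w. place v w \<in> U}
    | Inr e \<Rightarrow> F (Inr e) \<inter> {w. place (h e) w \<in> U} \<inter> {w. place (t e) w \<in> U})"

lemma Gamma_ht_induced: "Gamma_ht E h t (\<lambda>e. F (Inr e)) U = sheaf_V E (\<lambda>e. induced U (Inr e))"
  by (auto simp: Gamma_ht_def sheaf_V_def induced_def)

lemma induced_sub:
  assumes "S.subspace U" "U \<subseteq> sheaf_V V (\<lambda>v. F (Inl v))"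
  shows "sub (induced U)"
proof -
  have vs: "G.subspace {w. place v w \<in> U}" for v
    by (rule module_hom.subspace_linear_preimage[OF module_hom_place assms(1)])
  have "{w. place v w \<in> U} \<subseteq> F (Inl v)" if "v \<in> V" for v
  proof
    fix w assume "w \<in> {w. place v w \<in> U}"
    then have "place v w \<in> sheaf_V V (\<lambda>v. F (Inl v))" using assms(2) by auto
    then have "place v w v \<in> F (Inl v)" using that unfolding sheaf_V_def by blast
    then show "w \<in> F (Inl v)" by (simp add: place_def)
  qed
  then have "induced U (Inl v) \<subseteq> F (Inl v)" if "v \<in> V" for v
    using that by (simp add: induced_def)
  moreover have "induced U (Inr e) \<subseteq> F (Inr e)"
    "induced U (Inr e) \<subseteq> induced U (Inl (h e)) \<inter> induced U (Inl (t e))" for e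
    by (auto simp: induced_def)
  moreover have "G.subspace (induced U P)" if "P \<in> points V E" for P
    using vs subspace_F that by (cases P) (auto simp: induced_def intro!: G.subspace_inter)
  ultimately show ?thesis
    unfolding subsheaf_def points_def by auto
qed

lemma dim_sub_sheaf_V:
  assumes "sub A"
  shows "S.dim (sheaf_V V (\<lambda>v. A (Inl v))) = (\<Sum>v\<in>V. G.dim (A (Inl v)))"
    and "S.dim (sheaf_V E (\<lambda>e. A (Inr e))) = (\<Sum>e\<in>E. G.dim (A (Inr e)))"
proof -
  show "S.dim (sheaf_V V (\<lambda>v. A (Inl v))) = (\<Sum>v\<in>V. G.dim (A (Inl v)))"
    by (rule dim_sheaf_V[of V C])
      (use finite sub_subspace[OF assms] sub_support[OF assms, of "Inl _"] in simp_all)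
  show "S.dim (sheaf_V E (\<lambda>e. A (Inr e))) = (\<Sum>e\<in>E. G.dim (A (Inr e)))"
    by (rule dim_sheaf_V[of E C])
      (use finite sub_subspace[OF assms] sub_support[OF assms, of "Inr _"] in simp_all)
qed

lemma finite_span_sheaf_V:
  obtains T where "finite T" "sheaf_V V (\<lambda>v. F (Inl v)) \<subseteq> S.span T"
proof -
  obtain T where T: "finite T"
    "sheaf_V V (\<lambda>_. {a. \<forall>x. x \<notin> C \<longrightarrow> a x = (0::'a)}) \<subseteq> S.span T"
    using sheaf_V_finite_span[of V C] finite by blast
  have "sheaf_V V (\<lambda>v. F (Inl v)) \<subseteq> sheaf_V V (\<lambda>_. {a. \<forall>x. x \<notin> C \<longrightarrow> a x = (0::'a)})"
    using support_F[of "Inl _"] by (auto simp: sheaf_V_def)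
  then have "sheaf_V V (\<lambda>v. F (Inl v)) \<subseteq> S.span T" using T(2) by (rule subset_trans)
  with T(1) show ?thesis by (rule that)
qed

text \<open>Passing from \<open>U\<close> to the sum of its vectors concentrated at single vertices
  keeps the edge term and can only shrink the vertex term.\<close>

lemma excess_le_induced:
  assumes "S.subspace U" "U \<subseteq> sheaf_V V (\<lambda>v. F (Inl v))"
  shows "int (S.dim (Gamma_ht E h t (\<lambda>e. F (Inr e)) U)) - int (S.dim U) \<le> ex (induced U)"
proof -
  obtain T where T: "finite T" "sheaf_V V (\<lambda>v. F (Inl v)) \<subseteq> S.span T"
    by (rule finite_span_sheaf_V)
  have "f \<in> U" if "f \<in> sheaf_V V (\<lambda>v. induced U (Inl v))" for f
  proof -
    have "f = (\<Sum>v\<in>V. place v (f v))"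
    proof
      fix u
      have "(\<Sum>v\<in>V. place v (f v)) u = (\<Sum>v\<in>V. if v = u then f v else 0)"
        by (auto simp: sum_fun_at place_def intro!: sum.cong)
      also have "\<dots> = f u" using that finite by (auto simp: sheaf_V_def sum.delta)
      finally show "f u = (\<Sum>v\<in>V. place v (f v)) u" by simp
    qed
    moreover have "(\<Sum>v\<in>V. place v (f v)) \<in> U"
      using that by (intro S.subspace_sum assms) (auto simp: sheaf_V_def induced_def)
    ultimately show ?thesis by simp
  qed
  then have "S.dim (sheaf_V V (\<lambda>v. induced U (Inl v))) \<le> S.dim U"
    using T assms by (intro S.dim_mono_finite[of T]) (auto intro: S.span_base)
  then show ?thesis
    unfolding Gamma_ht_induced excess_def
    using dim_sub_sheaf_V[OF induced_sub[OF assms]] by (simp flip: of_nat_sum)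
qed

lemma ex_le: assumes "sub A" shows "ex A \<le> int (card E * card C)"
proof -
  have "(\<Sum>e\<in>E. int (G.dim (A (Inr e)))) \<le> (\<Sum>e\<in>E. int (card C))"
    using sub_dim_le[OF assms] by (intro sum_mono) simp
  moreover have "0 \<le> (\<Sum>v\<in>V. int (G.dim (A (Inl v))))" by (intro sum_nonneg) simp
  ultimately show ?thesis unfolding excess_def by simp
qed

lemma finite_excess_set: "finite excess_set"
proof -
  obtain T where T: "finite T" "sheaf_V V (\<lambda>v. F (Inl v)) \<subseteq> S.span T"
    by (rule finite_span_sheaf_V)
  have "excess_set \<subseteq> {- int (card T)..int (card E * card C)}"
  proof
    fix m assume "m \<in> excess_set"
    then obtain U where U: "S.subspace U" "U \<subseteq> sheaf_V V (\<lambda>v. F (Inl v))"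
      "m = int (S.dim (Gamma_ht E h t (\<lambda>e. F (Inr e)) U)) - int (S.dim U)"
      by (auto simp: excess_set_def)
    have "S.dim U \<le> card T" using U(2) T by (intro S.dim_le_card) auto
    moreover have "m \<le> int (card E * card C)"
      using excess_le_induced[OF U(1,2)] ex_le[OF induced_sub[OF U(1,2)]] U(3) by linarith
    ultimately show "m \<in> {- int (card T)..int (card E * card C)}" using U(3) by auto
  qed
  then show ?thesis by (rule finite_subset) simp
qed

text \<open>Take \<open>U\<close> to be the sum of the vertex stalks of \<open>A\<close>. Every edge
  stalk of \<open>A\<close> then sits inside that of \<open>induced U\<close>, so \<open>U\<close>
  achieves at least the excess of \<open>A\<close>.\<close>

lemma ex_le_me: assumes "sub A" shows "ex A \<le> me"
proof -
  define U where "U = sheaf_V V (\<lambda>v. A (Inl v))"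
  have A_le: "A P \<subseteq> F P" if "P \<in> points V E" for P
    using assms that by (simp add: subsheaf_def)
  have U: "S.subspace U" "U \<subseteq> sheaf_V V (\<lambda>v. F (Inl v))"
  proof -
    show "S.subspace U"
      unfolding U_def by (rule subspace_sheaf_V) (simp add: sub_subspace[OF assms])
    show "U \<subseteq> sheaf_V V (\<lambda>v. F (Inl v))"
    proof
      fix f assume "f \<in> U"
      then show "f \<in> sheaf_V V (\<lambda>v. F (Inl v))"
        using A_le[of "Inl _"] by (fastforce simp: U_def sheaf_V_def)
    qed
  qed
  have sub: "A (Inr e) \<subseteq> induced U (Inr e)" if "e \<in> E" for e
    using assms that ends[OF that] G.subspace_0[OF sub_subspace[OF assms]]
    unfolding induced_def U_def sheaf_V_def place_def subsheaf_def by auto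
  have "G.dim (A (Inr e)) \<le> G.dim (induced U (Inr e))" if "e \<in> E" for e
    using sub_span[OF induced_sub[OF U], of "Inr e"] that sub[OF that] finite(3)
    by (intro G.dim_mono_finite[of "delta ` C"]) (auto intro: G.span_base)
  then have "(\<Sum>e\<in>E. G.dim (A (Inr e))) \<le> S.dim (Gamma_ht E h t (\<lambda>e. F (Inr e)) U)"
    unfolding Gamma_ht_induced dim_sub_sheaf_V[OF induced_sub[OF U]] by (rule sum_mono)
  moreover have "S.dim U = (\<Sum>v\<in>V. G.dim (A (Inl v)))"
    unfolding U_def by (rule dim_sub_sheaf_V[OF assms])
  ultimately have "ex A \<le> int (S.dim (Gamma_ht E h t (\<lambda>e. F (Inr e)) U)) - int (S.dim U)"
    unfolding excess_def by (simp flip: of_nat_sum)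
  also have "\<dots> \<le> me"
    unfolding me_eq using U by (intro Max_ge finite_excess_set) (auto simp: excess_set_def)
  finally show ?thesis .
qed

lemma me_attained: "\<exists>A. sub A \<and> ex A = me"
proof -
  \<comment> \<open>The zero subspace shows that \<open>excess_set\<close> is nonempty, without
    which \<open>Max\<close> would carry no information.\<close>
  have "int (S.dim (Gamma_ht E h t (\<lambda>e. F (Inr e)) {0})) - int (S.dim {0 :: 'v \<Rightarrow> 'g \<Rightarrow> 'a})
    \<in> excess_set"
    using S.subspace_0[OF subspace_sheaf_V[of V "\<lambda>v. F (Inl v)"]] subspace_F
    unfolding excess_set_def by (intro CollectI exI[of _ "{0}"]) simp
  then have "me \<in> excess_set" unfolding me_eq by (intro Max_in finite_excess_set) auto
  then obtain U where U: "S.subspace U" "U \<subseteq> sheaf_V V (\<lambda>v. F (Inl v))"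
      "me = int (S.dim (Gamma_ht E h t (\<lambda>e. F (Inr e)) U)) - int (S.dim U)"
    by (auto simp: excess_set_def)
  then show ?thesis
    using excess_le_induced[OF U(1,2)] induced_sub[OF U(1,2)] ex_le_me by (metis antisym)
qed

lemma me_nonneg: "0 \<le> me"
proof -
  have "sub (\<lambda>_. {0})" using subspace_F G.subspace_0 unfolding subsheaf_def by auto
  from ex_le_me[OF this] show ?thesis by (simp add: excess_def G.dim_zero)
qed

lemma me_le: "me \<le> int (card E * card C)"
proof -
  obtain A where "sub A \<and> ex A = me" using me_attained by (rule exE)
  then show ?thesis using ex_le[of A] by simp
qed

text \<open>The excess is modular on the lattice of subsheaves, so maximisers are closed under
  intersection and there is a least one.\<close>

lemma ex_Int:
  assumes A: "sub A" "ex A = me" and B: "sub B" "ex B = me"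
  shows "sub (\<lambda>P. A P \<inter> B P)" "ex (\<lambda>P. A P \<inter> B P) = me"
proof -
  define D where "D P = {x + y |x y. x \<in> A P \<and> y \<in> B P}" for P
  show I: "sub (\<lambda>P. A P \<inter> B P)"
    using A(1) B(1) unfolding subsheaf_def by (auto intro!: G.subspace_inter)
  have D: "sub D"
    unfolding subsheaf_def
  proof (intro conjI ballI)
    fix P assume P: "P \<in> points V E"
    show "G.subspace (D P)"
      unfolding D_def by (intro G.subspace_sums sub_subspace A B P)
    have "A P \<subseteq> F P" "B P \<subseteq> F P" using A(1) B(1) P by (auto simp: subsheaf_def)
    then show "D P \<subseteq> F P" using G.subspace_add[OF subspace_F[OF P]] by (auto simp: D_def)
  next
    fix e assume e: "e \<in> E"
    have "A (Inr e) \<subseteq> A (Inl (h e)) \<inter> A (Inl (t e))" "B (Inr e) \<subseteq> B (Inl (h e)) \<inter> B (Inl (t e))"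
      using A(1) B(1) e by (auto simp: subsheaf_def)
    then show "D (Inr e) \<subseteq> D (Inl (h e)) \<inter> D (Inl (t e))" unfolding D_def by blast
  qed
  have "G.dim (D P) + G.dim (A P \<inter> B P) = G.dim (A P) + G.dim (B P)" if "P \<in> points V E" for P
    unfolding D_def using that
    by (intro G.dim_sum_Int_finite[of "delta ` C"] sub_subspace sub_span A B) (simp_all add: finite)
  then have *: "int (G.dim (D P)) = int (G.dim (A P)) + int (G.dim (B P)) - int (G.dim (A P \<inter> B P))"
    if "P \<in> points V E" for P
    using that by (smt (verit) of_nat_add)
  have "ex D = ex A + ex B - ex (\<lambda>P. A P \<inter> B P)"
    unfolding excess_def by (simp add: * sum.distrib sum_subtractf)
  \<comment> \<open>Neither the sum nor the intersection exceeds \<open>me\<close>, and their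
    excesses add up to twice \<open>me\<close>, so both attain it.\<close>
  then show "ex (\<lambda>P. A P \<inter> B P) = me"
    using ex_le_me[OF D] ex_le_me[OF I] A B by simp
qed

text \<open>Minimise the total dimension among maximisers. The intersection with another maximiser
  \<open>B\<close> is again a maximiser and cannot have smaller total, so no stalk of
  \<open>A\<close> shrinks and the dimensions compare point by point.\<close>

lemma least_maximiser:
  obtains A where "sub A" "ex A = me"
    "\<And>B P. sub B \<Longrightarrow> ex B = me \<Longrightarrow> P \<in> points V E \<Longrightarrow> G.dim (A P) \<le> G.dim (B P)"
proof -
  define total where "total A = (\<Sum>P\<in>points V E. G.dim (A P))" for A :: "'v + 'e \<Rightarrow> ('g \<Rightarrow> 'a) set"
  have "\<exists>A. (sub A \<and> ex A = me) \<and> (\<forall>B. sub B \<and> ex B = me \<longrightarrow> total A \<le> total B)"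
    using me_attained ex_has_least_nat[of "\<lambda>A. sub A \<and> ex A = me" _ total] by blast
  then obtain A where "(sub A \<and> ex A = me) \<and> (\<forall>B. sub B \<and> ex B = me \<longrightarrow> total A \<le> total B)"
    by (rule exE)
  then have A: "sub A" "ex A = me" "sub B \<Longrightarrow> ex B = me \<Longrightarrow> total A \<le> total B" for B
    by simp_all
  show ?thesis
  proof (rule that[OF A(1,2)])
    fix B P assume B: "sub B" "ex B = me" and P: "P \<in> points V E"
    have AB: "G.dim (A Q \<inter> B Q) \<le> G.dim (A Q)" "G.dim (A Q \<inter> B Q) \<le> G.dim (B Q)"
      if "Q \<in> points V E" for Q
      using sub_span[OF A(1) that] sub_span[OF B(1) that] finite(3)
      by (auto intro!: G.dim_mono_finite[of "delta ` C"] G.span_base)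
    have "total A \<le> total (\<lambda>P. A P \<inter> B P)" by (rule A(3)) (rule ex_Int[OF A(1,2) B])+
    moreover have "total (\<lambda>P. A P \<inter> B P) \<le> total A" unfolding total_def by (rule sum_mono) (rule AB)
    ultimately have "total (\<lambda>P. A P \<inter> B P) = total A" by simp
    then have "G.dim (A P \<inter> B P) = G.dim (A P)"
      unfolding total_def by (rule sum_mono_inv[OF _ AB(1) P finite_points])
    then show "G.dim (A P) \<le> G.dim (B P)" using AB(2)[OF P] by simp
  qed
qed

end

section \<open>Zariski density\<close>

lemma mats_line:
  "M \<in> mats Gr k \<Longrightarrow> N \<in> mats Gr k \<Longrightarrow> (\<lambda>i x. M i x + s * (N i x - M i x)) \<in> mats Gr k"
  by (auto simp: mats_def)

lemma polyfun_line:
  assumes "p \<in> polyfun Gr k"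
  shows "\<exists>P. \<forall>s. p (\<lambda>i x. M i x + s * (N i x - M i x)) = poly P s"
  using assms
proof induction
  case (pf_const c)
  show ?case by (intro exI[of _ "[:c:]"]) simp
next
  case (pf_var i x)
  show ?case by (intro exI[of _ "[:M i x, N i x - M i x:]"]) simp
next
  case (pf_add p q)
  then obtain P Q where "\<forall>s. p (\<lambda>i x. M i x + s * (N i x - M i x)) = poly P s"
    "\<forall>s. q (\<lambda>i x. M i x + s * (N i x - M i x)) = poly Q s" by auto
  then show ?case by (intro exI[of _ "P + Q"]) simp
next
  case (pf_mult p q)
  then obtain P Q where "\<forall>s. p (\<lambda>i x. M i x + s * (N i x - M i x)) = poly P s"
    "\<forall>s. q (\<lambda>i x. M i x + s * (N i x - M i x)) = poly Q s" by auto
  then show ?case by (intro exI[of _ "P * Q"]) simp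
qed

text \<open>Irreducibility of the matrix space, proved without ideals: on the line through
  \<open>M\<close> and \<open>N\<close> both functions become nonzero polynomials in
  \<open>s\<close>, whose finitely many roots cannot exhaust an infinite field.\<close>

lemma polyfun_common_nonzero:
  fixes p q :: "(nat \<Rightarrow> 'g \<Rightarrow> 'a::field) \<Rightarrow> 'a"
  assumes inf: "infinite (UNIV :: 'a set)"
    and p: "p \<in> polyfun Gr k" "M \<in> mats Gr k" "p M \<noteq> 0"
    and q: "q \<in> polyfun Gr k" "N \<in> mats Gr k" "q N \<noteq> 0"
  shows "\<exists>R\<in>mats Gr k. p R \<noteq> 0 \<and> q R \<noteq> 0"
proof -
  define L where "L s = (\<lambda>i x. M i x + s * (N i x - M i x))" for s
  obtain P Q where PQ: "\<And>s. p (L s) = poly P s" "\<And>s. q (L s) = poly Q s"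
    using polyfun_line[OF p(1), of M N] polyfun_line[OF q(1), of M N] unfolding L_def by auto
  have "L 0 = M" "L 1 = N" by (auto simp: L_def)
  then have "poly P 0 \<noteq> 0" "poly Q 1 \<noteq> 0" using PQ p q by metis+
  then have "P * Q \<noteq> 0" by auto
  then have "finite {s. poly (P * Q) s = 0}" by (rule poly_roots_finite)
  then obtain s where "s \<notin> {s. poly (P * Q) s = 0}" using inf by (meson ex_new_if_finite)
  then have "p (L s) \<noteq> 0 \<and> q (L s) \<noteq> 0" by (simp add: PQ)
  moreover have "L s \<in> mats Gr k" unfolding L_def by (rule mats_line[OF p(2) q(2)])
  ultimately show ?thesis by blast
qed

lemma polyfun_sum:
  "(\<And>i. i \<in> I \<Longrightarrow> p i \<in> polyfun Gr k) \<Longrightarrow> (\<lambda>M. \<Sum>i\<in>I. p i M) \<in> polyfun Gr k"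
  by (induction I rule: infinite_finite_induct) (auto intro: polyfun.intros)

lemma polyfun_prod:
  "(\<And>i. i \<in> I \<Longrightarrow> p i \<in> polyfun Gr k) \<Longrightarrow> (\<lambda>M. \<Prod>i\<in>I. p i M) \<in> polyfun Gr k"
  by (induction I rule: infinite_finite_induct) (auto intro: polyfun.intros)

lemma zariski_denseD:
  "zariski_dense Gr k S \<Longrightarrow> p \<in> polyfun Gr k \<Longrightarrow> M \<in> mats Gr k \<Longrightarrow> p M \<noteq> 0 \<Longrightarrow> \<exists>N\<in>S. p N \<noteq> 0"
  unfolding zariski_dense_def by blast

lemma not_zariski_denseE:
  assumes "\<not> zariski_dense Gr k S" "S \<subseteq> mats Gr k"
  obtains p M where "p \<in> polyfun Gr k" "\<forall>M\<in>S. p M = 0" "M \<in> mats Gr k" "p M \<noteq> 0"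
  using assms unfolding zariski_dense_def by auto

lemma zero_mats: "(\<lambda>i x. 0) \<in> mats Gr k"
  by (simp add: mats_def)

lemma zariski_dense_nonempty:
  fixes S :: "(nat \<Rightarrow> 'g \<Rightarrow> 'a::field) set"
  assumes "zariski_dense Gr k S" shows "S \<noteq> {}"
  using zariski_denseD[OF assms polyfun.pf_const[of 1] zero_mats] by auto

lemma zariski_dense_mono:
  assumes "zariski_dense Gr k S" "S \<subseteq> T" "T \<subseteq> mats Gr k"
  shows "zariski_dense Gr k T"
  using assms unfolding zariski_dense_def by (meson subsetD)

text \<open>If \<open>p\<close> and \<open>q\<close> witness that neither part is dense, their
  product vanishes on the union but, by irreducibility, not everywhere.\<close>

lemma zariski_dense_Un:
  fixes S T :: "(nat \<Rightarrow> 'g \<Rightarrow> 'a::field) set"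
  assumes inf: "infinite (UNIV :: 'a set)" and dense: "zariski_dense Gr k (S \<union> T)"
  shows "zariski_dense Gr k S \<or> zariski_dense Gr k T"
proof (rule ccontr)
  assume "\<not> ?thesis"
  then have nd: "\<not> zariski_dense Gr k S" "\<not> zariski_dense Gr k T" by simp_all
  have sub: "S \<subseteq> mats Gr k" "T \<subseteq> mats Gr k" using dense by (auto simp: zariski_dense_def)
  obtain p M where p: "p \<in> polyfun Gr k" "\<forall>M\<in>S. p M = 0" "M \<in> mats Gr k" "p M \<noteq> 0"
    by (rule not_zariski_denseE[OF nd(1) sub(1)])
  obtain q N where q: "q \<in> polyfun Gr k" "\<forall>M\<in>T. q M = 0" "N \<in> mats Gr k" "q N \<noteq> 0"
    by (rule not_zariski_denseE[OF nd(2) sub(2)])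
  obtain R where R: "R \<in> mats Gr k" "p R \<noteq> 0" "q R \<noteq> 0"
    using polyfun_common_nonzero[OF inf p(1,3,4) q(1,3,4)] by auto
  have "\<exists>N\<in>S \<union> T. p N * q N \<noteq> 0"
    by (rule zariski_denseD[OF dense polyfun.pf_mult[OF p(1) q(1)] R(1)]) (use R in simp)
  then show False using p(2) q(2) by auto
qed

lemma zariski_dense_UN:
  fixes S :: "'i \<Rightarrow> (nat \<Rightarrow> 'g \<Rightarrow> 'a::field) set"
  assumes inf: "infinite (UNIV :: 'a set)" and "finite I" and "zariski_dense Gr k (\<Union>i\<in>I. S i)"
  shows "\<exists>i\<in>I. zariski_dense Gr k (S i)"
  using assms(2,3)
proof (induction I rule: finite_induct)
  case empty
  then show ?case using zariski_dense_nonempty by auto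
next
  case (insert i I)
  then have "zariski_dense Gr k (S i \<union> (\<Union>i\<in>I. S i))" by simp
  then show ?case using zariski_dense_Un[OF inf] insert.IH by blast
qed

section \<open>Matrices as points of an affine space\<close>

text \<open>One type of variables for the matrix entries and for all existential witnesses. The
  natural-number indices are unbounded, so the type is infinite, and the witnesses are eliminated by
  a projection along an infinite set of variables.\<close>

datatype ('g, 'p, 'e) unknown =
  Entry nat 'g | Basis 'p nat 'g | Dual 'p nat 'g | Head 'e nat nat | Tail 'e nat nat

text \<open>With 0 for witness variables and for indices outside the matrix, every coordinate is a
  constant or a permitted variable, so polynomial maps pull back into
  \<open>polyfun\<close>.\<close>

definition entries :: "('g, 'b) monoid_scheme \<Rightarrow> nat \<Rightarrow> (nat \<Rightarrow> 'g \<Rightarrow> 'a::field)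
    \<Rightarrow> ('g, 'p, 'e) unknown \<Rightarrow> 'a" where
  "entries Gr k M v = (case v of Entry i x \<Rightarrow> if i < k \<and> x \<in> carrier Gr then M i x else 0 | _ \<Rightarrow> 0)"

lemma polynomial_maps_entries:
  assumes "p \<in> polynomial_maps"
  shows "(\<lambda>M. p (entries Gr k M)) \<in> polyfun Gr k"
  using assms
proof induction
  case (var v)
  show ?case
  proof (cases v)
    case (Entry i x)
    then show ?thesis
      by (cases "i < k \<and> x \<in> carrier Gr") (auto simp: entries_def intro: polyfun.intros)
  qed (auto simp: entries_def intro: polyfun.intros)
qed (auto intro: polyfun.intros)

text \<open>By irreducibility one basic set of the union has a dense preimage. Its equations vanish
  on that dense set, hence on all matrices, so there the inequation alone decides
  membership.\<close>

lemma constructible_dense_open: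
  fixes A :: "(('g, 'p, 'e) unknown \<Rightarrow> 'a::field) set"
  assumes inf: "infinite (UNIV :: 'a set)" and A: "A \<in> constructible"
    and dense: "zariski_dense Gr k {M \<in> mats Gr k. entries Gr k M \<in> A}"
  obtains q N where "q \<in> polyfun Gr k" "N \<in> mats Gr k" "q N \<noteq> 0"
    "\<And>M. M \<in> mats Gr k \<Longrightarrow> q M \<noteq> 0 \<Longrightarrow> entries Gr k M \<in> A"
proof -
  obtain \<B> where B: "finite \<B>" "\<B> \<subseteq> basic_sets" "A = \<Union>\<B>"
    using constructible_finite_union[OF A] by blast
  have "{M \<in> mats Gr k. entries Gr k M \<in> A} = (\<Union>S\<in>\<B>. {M \<in> mats Gr k. entries Gr k M \<in> S})"
    using B(3) by auto
  then have "zariski_dense Gr k (\<Union>S\<in>\<B>. {M \<in> mats Gr k. entries Gr k M \<in> S})" using dense by simp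
  from zariski_dense_UN[OF inf B(1) this]
  obtain S where S: "S \<in> \<B>" "zariski_dense Gr k {M \<in> mats Gr k. entries Gr k M \<in> S}"
    by (rule bexE)
  obtain Z q where Zq: "S = {x. (\<forall>p\<in>Z. p x = 0) \<and> q x \<noteq> 0}" "Z \<subseteq> polynomial_maps"
      "q \<in> polynomial_maps"
    using subsetD[OF B(2) S(1)] unfolding basic_sets_def by auto
  obtain N where N: "N \<in> mats Gr k" "entries Gr k N \<in> S"
    using zariski_dense_nonempty[OF S(2)] by auto
  show ?thesis
  proof (rule that[of "\<lambda>M. q (entries Gr k M)" N])
    show "(\<lambda>M. q (entries Gr k M)) \<in> polyfun Gr k" by (rule polynomial_maps_entries[OF Zq(3)])
    show "N \<in> mats Gr k" "q (entries Gr k N) \<noteq> 0" using N Zq(1) by auto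
    fix M assume M: "M \<in> mats Gr k" "q (entries Gr k M) \<noteq> 0"
    have "p (entries Gr k M) = 0" if "p \<in> Z" for p
    proof (rule ccontr)
      assume "p (entries Gr k M) \<noteq> 0"
      moreover have "(\<lambda>M. p (entries Gr k M)) \<in> polyfun Gr k"
        by (rule polynomial_maps_entries) (use that Zq(2) in blast)
      ultimately have "\<exists>N\<in>{M \<in> mats Gr k. entries Gr k M \<in> S}. p (entries Gr k N) \<noteq> 0"
        using zariski_denseD[OF S(2), of "\<lambda>M. p (entries Gr k M)", OF _ M(1)] by simp
      then show False using that Zq(1) by auto
    qed
    then have "entries Gr k M \<in> S" using M(2) Zq(1) by simp
    then show "entries Gr k M \<in> A" using S(1) B(3) by blast
  qed
qed

section \<open>Subsheaves with prescribed dimensions\<close>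

locale cayley_bigraph = group Gr for Gr :: "('g, 'b) monoid_scheme" (structure) +
  fixes g1 g2 :: 'g and VL :: "'g set" and EL :: "('g \<times> nat) set"
  assumes finite_carrier: "finite (carrier Gr)"
    and generators: "g1 \<in> carrier Gr" "g2 \<in> carrier Gr"
    and subgraph: "is_subgraph Gr g1 g2 VL EL"
begin

abbreviation "head \<equiv> cay_head Gr g1 g2"
abbreviation "pts \<equiv> cay_points Gr"
abbreviation "edges \<equiv> cay_edges Gr"

lemma pts_eq: "pts = points (carrier Gr) edges"
  by (simp add: cay_points_def points_def)

lemma finite_edges: "finite edges"
  using finite_carrier by (simp add: cay_edges_def)

lemma finite_pts: "finite pts"
  using finite_carrier finite_edges by (simp add: cay_points_def)

lemma head_tail_closed: "e \<in> edges \<Longrightarrow> head e \<in> carrier Gr" "e \<in> edges \<Longrightarrow> cay_tail e \<in> carrier Gr"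
  using generators by (auto simp: cay_edges_def cay_head_def cay_tail_def)

lemma GL_subset: "GL Gr VL EL P \<subseteq> carrier Gr"
  by (auto simp: GL_def)

lemma finite_sheaf_K:
  "finite_sheaf (carrier Gr) edges head cay_tail (carrier Gr) (K_sheaf Gr VL EL k (M :: nat \<Rightarrow> 'g \<Rightarrow> 'a::field))"
proof
  show "G.subspace (K_sheaf Gr VL EL k M P)" for P
    by (rule G.subspaceI)
      (auto simp: K_sheaf_def gscale_def sum.distrib distrib_right mult.assoc simp flip: sum_distrib_left)
  show "a x = 0" if "a \<in> K_sheaf Gr VL EL k M P" "x \<notin> carrier Gr" for a P x
    using that GL_subset by (auto simp: K_sheaf_def)
qed (use finite_carrier finite_edges head_tail_closed in auto)

text \<open>A subsheaf with dimensions \<open>d\<close> is encoded by existentially quantified solutions of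
  polynomial equations: bases \<open>b P\<close> of the stalks, dual families \<open>b' P\<close> certifying their
  linear independence, and coefficients \<open>\<alpha>\<close>, \<open>\<beta>\<close> certifying that the stalk at
  an edge lies in the stalks at its head and its tail.\<close>

definition presented :: "nat \<Rightarrow> ('g + 'g \<times> nat \<Rightarrow> nat) \<Rightarrow> (nat \<Rightarrow> 'g \<Rightarrow> 'a::field)
    \<Rightarrow> ('g + 'g \<times> nat \<Rightarrow> nat \<Rightarrow> 'g \<Rightarrow> 'a) \<Rightarrow> ('g + 'g \<times> nat \<Rightarrow> nat \<Rightarrow> 'g \<Rightarrow> 'a)
    \<Rightarrow> ('g \<times> nat \<Rightarrow> nat \<Rightarrow> nat \<Rightarrow> 'a) \<Rightarrow> ('g \<times> nat \<Rightarrow> nat \<Rightarrow> nat \<Rightarrow> 'a) \<Rightarrow> bool" where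
  "presented k d M b b' \<alpha> \<beta> \<longleftrightarrow>
    (\<forall>P\<in>pts. \<forall>j\<in>{..<d P}. \<forall>x\<in>carrier Gr - GL Gr VL EL P. b P j x = 0) \<and>
    (\<forall>P\<in>pts. \<forall>j\<in>{..<d P}. \<forall>i\<in>{..<k}. (\<Sum>x\<in>carrier Gr. b P j x * M i x) = 0) \<and>
    (\<forall>P\<in>pts. \<forall>j\<in>{..<d P}. \<forall>l\<in>{..<d P}.
      (\<Sum>x\<in>carrier Gr. b' P j x * b P l x) = (if j = l then 1 else 0)) \<and>
    (\<forall>e\<in>edges. \<forall>j\<in>{..<d (Inr e)}. \<forall>x\<in>carrier Gr.
      b (Inr e) j x = (\<Sum>l<d (Inl (head e)). \<alpha> e j l * b (Inl (head e)) l x)) \<and>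
    (\<forall>e\<in>edges. \<forall>j\<in>{..<d (Inr e)}. \<forall>x\<in>carrier Gr.
      b (Inr e) j x = (\<Sum>l<d (Inl (cay_tail e)). \<beta> e j l * b (Inl (cay_tail e)) l x))"

definition with_dims :: "nat \<Rightarrow> ('g + 'g \<times> nat \<Rightarrow> nat) \<Rightarrow> (nat \<Rightarrow> 'g \<Rightarrow> 'a::field) set" where
  "with_dims k d = {M \<in> mats Gr k. \<exists>b b' \<alpha> \<beta>. presented k d M b b' \<alpha> \<beta>}"

lemma with_dimsI:
  fixes M :: "nat \<Rightarrow> 'g \<Rightarrow> 'a::field"
  assumes M: "M \<in> mats Gr k"
    and A: "subsheaf (carrier Gr) edges head cay_tail (K_sheaf Gr VL EL k M) A"
    and d: "\<And>P. P \<in> pts \<Longrightarrow> d P = G.dim (A P)"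
  shows "M \<in> with_dims k d"
proof -
  interpret finite_sheaf "carrier Gr" edges head cay_tail "carrier Gr" "K_sheaf Gr VL EL k M"
    by (rule finite_sheaf_K)
  define good where "good P bb \<longleftrightarrow> (\<forall>j<d P. fst bb j \<in> A P) \<and>
      (\<forall>w\<in>A P. \<exists>c. \<forall>x. w x = (\<Sum>j<d P. c j * fst bb j x)) \<and>
      (\<forall>j<d P. \<forall>l<d P. (\<Sum>x\<in>carrier Gr. snd bb j x * fst bb l x) = (if j = l then 1 else 0))"
    for P and bb :: "(nat \<Rightarrow> 'g \<Rightarrow> 'a) \<times> (nat \<Rightarrow> 'g \<Rightarrow> 'a)"
  have "\<exists>bb. good P bb" if P: "P \<in> pts" for P
  proof (rule dual_basis_exists[where C = "carrier Gr" and A = "A P"])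
    show "finite (carrier Gr)" by (rule finite_carrier)
    show "a x = 0" if "a \<in> A P" "x \<notin> carrier Gr" for a x
      using sub_support[OF A] P that by (simp add: pts_eq)
    fix b b' :: "nat \<Rightarrow> 'g \<Rightarrow> 'a"
    assume "\<And>j. j < G.dim (A P) \<Longrightarrow> b j \<in> A P"
      and "\<And>w. w \<in> A P \<Longrightarrow> \<exists>c. \<forall>x. w x = (\<Sum>j<G.dim (A P). c j * b j x)"
      and "\<And>j l. j < G.dim (A P) \<Longrightarrow> l < G.dim (A P) \<Longrightarrow>
        (\<Sum>x\<in>carrier Gr. b' j x * b l x) = (if j = l then 1 else 0)"
    then have "good P (b, b')" by (simp add: good_def d[OF P])
    then show ?thesis by (rule exI)
  qed
  then obtain f where "good P (f P)" if "P \<in> pts" for P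
    using bchoice[of pts good] by blast
  define b b' where "b P = fst (f P)" and "b' P = snd (f P)" for P
  have good: "good P (b P, b' P)" if "P \<in> pts" for P
    using \<open>\<And>P. P \<in> pts \<Longrightarrow> good P (f P)\<close>[OF that] by (simp add: b_def b'_def)
  have b: "\<And>P j. P \<in> pts \<Longrightarrow> j < d P \<Longrightarrow> b P j \<in> A P"
    "\<And>P w. P \<in> pts \<Longrightarrow> w \<in> A P \<Longrightarrow> \<exists>c. \<forall>x. w x = (\<Sum>j<d P. c j * b P j x)"
    "\<And>P j l. P \<in> pts \<Longrightarrow> j < d P \<Longrightarrow> l < d P \<Longrightarrow>
      (\<Sum>x\<in>carrier Gr. b' P j x * b P l x) = (if j = l then 1 else (0::'a))"
    using good by (simp_all add: good_def)
  have bK: "b P j \<in> K_sheaf Gr VL EL k M P" if "P \<in> pts" "j < d P" for P j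
    using b(1)[OF that] A that(1) unfolding subsheaf_def pts_eq by blast
  have ends: "b (Inr e) j \<in> A (Inl (head e))" "b (Inr e) j \<in> A (Inl (cay_tail e))"
    if "e \<in> edges" "j < d (Inr e)" for e j
  proof -
    have "b (Inr e) j \<in> A (Inr e)" using b(1) that by (simp add: pts_eq)
    moreover have "A (Inr e) \<subseteq> A (Inl (head e)) \<inter> A (Inl (cay_tail e))"
      using A that(1) unfolding subsheaf_def by blast
    ultimately show "b (Inr e) j \<in> A (Inl (head e))" "b (Inr e) j \<in> A (Inl (cay_tail e))" by auto
  qed
  define coeffs where "coeffs P w = (SOME c. \<forall>x. w x = (\<Sum>j<d P. c j * b P j x))" for P w
  have coeffs: "w x = (\<Sum>j<d P. coeffs P w j * b P j x)" if "P \<in> pts" "w \<in> A P" for P w x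
    using someI_ex[OF b(2)[OF that]] unfolding coeffs_def by blast
  have "presented k d M b b' (\<lambda>e j. coeffs (Inl (head e)) (b (Inr e) j))
      (\<lambda>e j. coeffs (Inl (cay_tail e)) (b (Inr e) j))"
    unfolding presented_def
  proof (intro conjI ballI)
    fix P j x assume "P \<in> pts" "j \<in> {..<d P}" "x \<in> carrier Gr - GL Gr VL EL P"
    then show "b P j x = 0" using bK[of P j] by (simp add: K_sheaf_def)
  next
    fix P j i assume "P \<in> pts" "j \<in> {..<d P}" "i \<in> {..<k}"
    then show "(\<Sum>x\<in>carrier Gr. b P j x * M i x) = 0" using bK[of P j] by (simp add: K_sheaf_def)
  next
    fix P j l assume "P \<in> pts" "j \<in> {..<d P}" "l \<in> {..<d P}"
    then show "(\<Sum>x\<in>carrier Gr. b' P j x * b P l x) = (if j = l then 1 else 0)"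
      using b(3) by simp
  next
    fix e j x assume e: "e \<in> edges" "j \<in> {..<d (Inr e)}"
    show "b (Inr e) j x
        = (\<Sum>l<d (Inl (head e)). coeffs (Inl (head e)) (b (Inr e) j) l * b (Inl (head e)) l x)"
      by (rule coeffs) (use e ends head_tail_closed in \<open>simp_all add: pts_eq\<close>)
    show "b (Inr e) j x
        = (\<Sum>l<d (Inl (cay_tail e)). coeffs (Inl (cay_tail e)) (b (Inr e) j) l * b (Inl (cay_tail e)) l x)"
      by (rule coeffs) (use e ends head_tail_closed in \<open>simp_all add: pts_eq\<close>)
  qed
  then show ?thesis unfolding with_dims_def using M by blast
qed

lemma with_dimsE:
  fixes M :: "nat \<Rightarrow> 'g \<Rightarrow> 'a::field"
  assumes "M \<in> with_dims k d"
  obtains A where "subsheaf (carrier Gr) edges head cay_tail (K_sheaf Gr VL EL k M) A"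
    "\<And>P. P \<in> pts \<Longrightarrow> G.dim (A P) = d P"
proof -
  obtain b b' \<alpha> \<beta> where pr: "presented k d M b b' \<alpha> \<beta>"
    using assms unfolding with_dims_def by auto
  interpret finite_sheaf "carrier Gr" edges head cay_tail "carrier Gr" "K_sheaf Gr VL EL k M"
    by (rule finite_sheaf_K)
  \<comment> \<open>The equations constrain \<open>b\<close> on the carrier only. Elements of the
    stalks vanish elsewhere, so the other values are cut off before spanning.\<close>
  define c where "c P j = (\<lambda>x. if x \<in> carrier Gr then b P j x else 0)" for P j
  define A where "A P = G.span (c P ` {..<d P})" for P
  have cK: "c P j \<in> K_sheaf Gr VL EL k M P" if "P \<in> pts" "j < d P" for P j
    using that pr GL_subset[of P] unfolding presented_def K_sheaf_def c_def by auto
  have cont: "A (Inr e) \<subseteq> A (Inl v)"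
    if ex: "\<exists>\<gamma>. \<forall>j<d (Inr e). \<forall>x\<in>carrier Gr. b (Inr e) j x = (\<Sum>l<d (Inl v). \<gamma> j l * b (Inl v) l x)"
    for e v
  proof -
    obtain \<gamma> where eq: "b (Inr e) j x = (\<Sum>l<d (Inl v). \<gamma> j l * b (Inl v) l x)"
      if "j < d (Inr e)" "x \<in> carrier Gr" for j x
      using ex by auto
    have "c (Inr e) j \<in> A (Inl v)" if "j < d (Inr e)" for j
    proof -
      have "c (Inr e) j = (\<Sum>l<d (Inl v). gscale (\<gamma> j l) (c (Inl v) l))"
        using eq[OF that]
        by (auto simp: fun_eq_iff c_def sum_fun_at gscale_def)
      also have "\<dots> \<in> A (Inl v)"
        unfolding A_def by (intro G.span_sum G.span_scale G.span_base) auto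
      finally show ?thesis .
    qed
    then show ?thesis unfolding A_def by (intro G.span_minimal) (auto simp: A_def)
  qed
  have "sub A"
    unfolding subsheaf_def
  proof (intro conjI ballI)
    show "G.subspace (A P)" for P by (simp add: A_def)
    show "A P \<subseteq> K_sheaf Gr VL EL k M P" if "P \<in> points (carrier Gr) edges" for P
      unfolding A_def using that cK[of P] subspace_F[OF that]
      by (intro G.span_minimal) (auto simp: pts_eq)
    show "A (Inr e) \<subseteq> A (Inl (head e)) \<inter> A (Inl (cay_tail e))" if "e \<in> edges" for e
    proof -
      have "A (Inr e) \<subseteq> A (Inl (head e))"
        by (rule cont, rule exI[of _ "\<alpha> e"], intro allI impI) (use that pr in \<open>auto simp only: presented_def lessThan_iff\<close>)
      moreover have "A (Inr e) \<subseteq> A (Inl (cay_tail e))"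
        by (rule cont, rule exI[of _ "\<beta> e"], intro allI impI) (use that pr in \<open>auto simp only: presented_def lessThan_iff\<close>)
      ultimately show ?thesis by blast
    qed
  qed
  moreover have "G.dim (A P) = d P" if "P \<in> pts" for P
    unfolding A_def
    by (rule dual_family_dim[where C = "carrier Gr" and b' = "b' P"])
      (use that pr in \<open>simp add: presented_def c_def\<close>)
  ultimately show ?thesis by (rule that)
qed

text \<open>Once \<open>d\<close> is fixed, every quantifier ranges over a finite set and every
  condition equates two polynomial maps. The index bounds in \<open>presented\<close> are written as
  sets to fit the rule for finite conjunctions.\<close>

lemma constructible_presented:
  "{x :: ('g, 'g + 'g \<times> nat, 'g \<times> nat) unknown \<Rightarrow> 'a::field.
    presented k d (\<lambda>i y. x (Entry i y)) (\<lambda>P j y. x (Basis P j y)) (\<lambda>P j y. x (Dual P j y))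
      (\<lambda>e j l. x (Head e j l)) (\<lambda>e j l. x (Tail e j l))} \<in> constructible"
  unfolding presented_def
  by (intro constructible_conj constructible_ball constructible_eq polynomial_maps_sum
      polynomial_maps.mult polynomial_maps.var polynomial_maps.const
      finite_pts finite_edges finite_carrier finite_lessThan finite_Diff)

lemma presented_entries_cong:
  assumes "\<And>i x. i < k \<Longrightarrow> x \<in> carrier Gr \<Longrightarrow> M i x = N i x"
  shows "presented k d M b b' \<alpha> \<beta> = presented k d N b b' \<alpha> \<beta>"
  unfolding presented_def using assms by (simp cong: sum.cong)

lemma with_dims_open:
  assumes ac: "algebraically_closed TYPE('a::field)"
    and dense: "zariski_dense Gr k (with_dims k d :: (nat \<Rightarrow> 'g \<Rightarrow> 'a) set)"
  obtains q N where "q \<in> polyfun Gr k" "N \<in> mats Gr k" "q N \<noteq> 0"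
    "\<And>M :: nat \<Rightarrow> 'g \<Rightarrow> 'a. M \<in> mats Gr k \<Longrightarrow> q M \<noteq> 0 \<Longrightarrow> M \<in> with_dims k d"
proof -
  define A where "A = {x :: ('g, 'g + 'g \<times> nat, 'g \<times> nat) unknown \<Rightarrow> 'a.
    presented k d (\<lambda>i y. x (Entry i y)) (\<lambda>P j y. x (Basis P j y)) (\<lambda>P j y. x (Dual P j y))
      (\<lambda>e j l. x (Head e j l)) (\<lambda>e j l. x (Tail e j l))}"
  \<comment> \<open>Everything except the matrix entries is quantified away. Taking a complement
    also captures the indices that \<open>presented\<close> never reads.\<close>
  define W where "W = - range (\<lambda>(i, x). Entry i x :: ('g, 'g + 'g \<times> nat, 'g \<times> nat) unknown)"
  define A' where "A' = {x. \<exists>y. (\<lambda>v. if v \<in> W then y v else x v) \<in> A}"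
  have W: "Entry i x \<notin> W" "Basis P j x \<in> W" "Dual P j x \<in> W" "Head e j l \<in> W" "Tail e j l \<in> W"
    for i x P j e l unfolding W_def by auto
  have A': "A' \<in> constructible"
    unfolding A'_def A_def by (rule constructible_projection_set[OF ac constructible_presented])
  have iff: "entries Gr k M \<in> A' \<longleftrightarrow> M \<in> with_dims k d" if "M \<in> mats Gr k" for M :: "nat \<Rightarrow> 'g \<Rightarrow> 'a"
  proof -
    have ent: "presented k d (\<lambda>i y. entries Gr k M (Entry i y :: ('g, 'g + 'g \<times> nat, 'g \<times> nat) unknown)) b b' \<alpha> \<beta>
      = presented k d M b b' \<alpha> \<beta>" for b b' \<alpha> \<beta>
      by (rule presented_entries_cong) (simp add: entries_def)
    have "entries Gr k M \<in> A' \<longleftrightarrow> (\<exists>y :: ('g, 'g + 'g \<times> nat, 'g \<times> nat) unknown \<Rightarrow> 'a.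
      presented k d M (\<lambda>P j x. y (Basis P j x)) (\<lambda>P j x. y (Dual P j x))
        (\<lambda>e j l. y (Head e j l)) (\<lambda>e j l. y (Tail e j l)))"
      unfolding A'_def A_def by (simp add: W ent)
    also have "\<dots> \<longleftrightarrow> (\<exists>b b' \<alpha> \<beta>. presented k d M b b' \<alpha> \<beta>)"
    proof
      assume "\<exists>b b' \<alpha> \<beta>. presented k d M b b' \<alpha> \<beta>"
      then obtain b b' \<alpha> \<beta> where *: "presented k d M b b' \<alpha> \<beta>" by auto
      show "\<exists>y :: ('g, 'g + 'g \<times> nat, 'g \<times> nat) unknown \<Rightarrow> 'a.
        presented k d M (\<lambda>P j x. y (Basis P j x)) (\<lambda>P j x. y (Dual P j x))
        (\<lambda>e j l. y (Head e j l)) (\<lambda>e j l. y (Tail e j l))"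
        by (rule exI[of _ "\<lambda>v. case v of Entry i x \<Rightarrow> 0 | Basis P j x \<Rightarrow> b P j x
          | Dual P j x \<Rightarrow> b' P j x | Head e j l \<Rightarrow> \<alpha> e j l | Tail e j l \<Rightarrow> \<beta> e j l"])
          (simp add: *)
    qed auto
    also have "\<dots> \<longleftrightarrow> M \<in> with_dims k d" using that by (simp add: with_dims_def)
    finally show ?thesis .
  qed
  have "with_dims k d \<subseteq> mats Gr k" by (auto simp: with_dims_def)
  then have "{M \<in> mats Gr k. entries Gr k M \<in> A'} = with_dims k d" using iff by auto
  then have "zariski_dense Gr k {M \<in> mats Gr k. entries Gr k M \<in> A'}" using dense by simp
  from constructible_dense_open[OF algebraically_closed_infinite[OF ac] A' this] iff that
  show ?thesis by metis
qed

section \<open>Action of right translation\<close>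

definition shift :: "'g \<Rightarrow> 'g + 'g \<times> nat \<Rightarrow> 'g + 'g \<times> nat" where
  "shift g P = (case P of Inl v \<Rightarrow> Inl (v \<otimes> g) | Inr e \<Rightarrow> Inr (fst e \<otimes> g, snd e))"

lemma shift_simps [simp]:
  "shift g (Inl v) = Inl (v \<otimes> g)" "shift g (Inr e) = Inr (fst e \<otimes> g, snd e)"
  by (simp_all add: shift_def)

lemma edges_shift: "g \<in> carrier Gr \<Longrightarrow> e \<in> edges \<Longrightarrow> (fst e \<otimes> g, snd e) \<in> edges"
  by (auto simp: cay_edges_def)

lemma pts_simps [simp]: "Inl v \<in> pts \<longleftrightarrow> v \<in> carrier Gr" "Inr e \<in> pts \<longleftrightarrow> e \<in> edges"
  by (auto simp: cay_points_def)

lemma pts_shift: "g \<in> carrier Gr \<Longrightarrow> P \<in> pts \<Longrightarrow> shift g P \<in> pts"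
  by (cases P) (auto simp: edges_shift)

lemma VL_carrier: "h \<in> VL \<Longrightarrow> h \<in> carrier Gr"
  using subgraph by (auto simp: is_subgraph_def)

lemma EL_carrier: "(h, i) \<in> EL \<Longrightarrow> h \<in> carrier Gr"
  using subgraph by (auto simp: is_subgraph_def cay_edges_def)

lemma GL_Inl: "x \<in> GL Gr VL EL (Inl v) \<longleftrightarrow> x \<in> carrier Gr \<and> (\<exists>h\<in>VL. v = h \<otimes> x)"
  by (auto simp: GL_def in_transl_def transl_V_def)

lemma GL_Inr: "x \<in> GL Gr VL EL (Inr (u, i)) \<longleftrightarrow> x \<in> carrier Gr \<and> (\<exists>h. (h, i) \<in> EL \<and> u = h \<otimes> x)"
  by (force simp: GL_def in_transl_def transl_E_def)

lemma right_translate_eq: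
  assumes "u \<in> carrier Gr" "h \<in> carrier Gr" "x \<in> carrier Gr" "g \<in> carrier Gr"
  shows "u \<otimes> g = h \<otimes> (x \<otimes> g) \<longleftrightarrow> u = h \<otimes> x"
  using assms by (simp flip: m_assoc)

text \<open>Translates satisfy \<open>L(xg) = (Lx)g\<close>, and right multiplication by
  \<open>g\<close> can be cancelled.\<close>

lemma GL_shift:
  assumes "g \<in> carrier Gr" "P \<in> pts" "x \<in> carrier Gr"
  shows "x \<otimes> g \<in> GL Gr VL EL (shift g P) \<longleftrightarrow> x \<in> GL Gr VL EL P"
proof (cases P)
  case (Inl v)
  then have v: "v \<in> carrier Gr" using assms by simp
  show ?thesis
    unfolding Inl shift_simps GL_Inl
    using assms by (auto simp: right_translate_eq[OF v VL_carrier assms(3,1)])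
next
  case (Inr e)
  obtain u i where e: "e = (u, i)" by fastforce
  then have u: "u \<in> carrier Gr" using assms Inr by (simp add: cay_edges_def)
  have "(\<exists>h. (h, i) \<in> EL \<and> u \<otimes> g = h \<otimes> (x \<otimes> g)) \<longleftrightarrow> (\<exists>h. (h, i) \<in> EL \<and> u = h \<otimes> x)"
    using right_translate_eq[OF u EL_carrier assms(3,1)] by blast
  then show ?thesis
    unfolding Inr e shift_simps GL_Inr fst_conv snd_conv using assms by simp
qed

text \<open>Generators act from the left and \<open>g\<close> from the right, so by associativity
  \<open>shift g\<close> respects incidence in the bigraph.\<close>

lemma head_shift:
  "g \<in> carrier Gr \<Longrightarrow> e \<in> edges \<Longrightarrow> head (fst e \<otimes> g, snd e) = head e \<otimes> g"
  using generators by (auto simp: cay_head_def cay_edges_def m_assoc)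

lemma bij_right_mult: "g \<in> carrier Gr \<Longrightarrow> bij_betw (\<lambda>x. x \<otimes> g) (carrier Gr) (carrier Gr)"
  by (rule bij_betwI[where g = "\<lambda>x. x \<otimes> inv g"]) (auto simp: m_assoc)

lemma sum_shift:
  "g \<in> carrier Gr \<Longrightarrow> (\<Sum>x\<in>carrier Gr. f (x \<otimes> g)) = (\<Sum>x\<in>carrier Gr. f x)"
  by (rule sum.reindex_bij_betw[OF bij_right_mult])

text \<open>The column at \<open>x\<close> is the old column at \<open>xg\<close>, so the sheaf of
  the new matrix at \<open>P\<close> is the old one at \<open>Pg\<close>, relabelled by right
  multiplication. The value 0 off the carrier keeps the result in \<open>mats\<close>.\<close>

definition translate :: "'g \<Rightarrow> (nat \<Rightarrow> 'g \<Rightarrow> 'a::field) \<Rightarrow> nat \<Rightarrow> 'g \<Rightarrow> 'a" where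
  "translate g M = (\<lambda>i x. if x \<in> carrier Gr then M i (x \<otimes> g) else 0)"

lemma translate_mats: "g \<in> carrier Gr \<Longrightarrow> M \<in> mats Gr k \<Longrightarrow> translate g M \<in> mats Gr k"
  by (auto simp: mats_def translate_def)

lemma translate_inv:
  assumes "g \<in> carrier Gr" "M \<in> mats Gr k"
  shows "translate g (translate (inv g) M) = M"
  using assms by (auto simp: mats_def translate_def fun_eq_iff m_assoc)

text \<open>All witnesses are transported: points by \<open>shift g\<close>, group indices by right
  multiplication. Sums are unchanged because the latter permutes the carrier.\<close>

lemma with_dims_translate:
  fixes M :: "nat \<Rightarrow> 'g \<Rightarrow> 'a::field"
  assumes g: "g \<in> carrier Gr" and M: "M \<in> with_dims k d"
  shows "translate g M \<in> with_dims k (d \<circ> shift g)"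
proof -
  obtain b b' \<alpha> \<beta> where pr: "presented k d M b b' \<alpha> \<beta>" and "M \<in> mats Gr k"
    using M unfolding with_dims_def by auto
  let ?e = "\<lambda>e. (fst e \<otimes> g, snd e)"
  have "presented k (d \<circ> shift g) (translate g M) (\<lambda>P j x. b (shift g P) j (x \<otimes> g))
    (\<lambda>P j x. b' (shift g P) j (x \<otimes> g)) (\<lambda>e. \<alpha> (?e e)) (\<lambda>e. \<beta> (?e e))"
    unfolding presented_def comp_def
  proof (intro conjI ballI)
    fix P j x assume *: "P \<in> pts" "j \<in> {..<d (shift g P)}" "x \<in> carrier Gr - GL Gr VL EL P"
    then have "x \<otimes> g \<in> carrier Gr - GL Gr VL EL (shift g P)" using GL_shift g by auto
    then show "b (shift g P) j (x \<otimes> g) = 0"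
      using pr * pts_shift[OF g] unfolding presented_def by blast
  next
    fix P j i assume *: "P \<in> pts" "j \<in> {..<d (shift g P)}" "i \<in> {..<k}"
    have "(\<Sum>x\<in>carrier Gr. b (shift g P) j (x \<otimes> g) * translate g M i x)
      = (\<Sum>x\<in>carrier Gr. b (shift g P) j (x \<otimes> g) * M i (x \<otimes> g))"
      by (rule sum.cong) (simp_all add: translate_def)
    also have "\<dots> = (\<Sum>x\<in>carrier Gr. b (shift g P) j x * M i x)" by (rule sum_shift[OF g])
    also have "\<dots> = 0" using pr * pts_shift[OF g] unfolding presented_def by blast
    finally show "(\<Sum>x\<in>carrier Gr. b (shift g P) j (x \<otimes> g) * translate g M i x) = 0" .
  next
    fix P j l assume *: "P \<in> pts" "j \<in> {..<d (shift g P)}" "l \<in> {..<d (shift g P)}"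
    have "(\<Sum>x\<in>carrier Gr. b' (shift g P) j (x \<otimes> g) * b (shift g P) l (x \<otimes> g))
      = (\<Sum>x\<in>carrier Gr. b' (shift g P) j x * b (shift g P) l x)" by (rule sum_shift[OF g])
    also have "\<dots> = (if j = l then 1 else 0)"
      using pr * pts_shift[OF g] unfolding presented_def by blast
    finally show "(\<Sum>x\<in>carrier Gr. b' (shift g P) j (x \<otimes> g) * b (shift g P) l (x \<otimes> g))
      = (if j = l then 1 else 0)" .
  next
    fix e j x assume *: "e \<in> edges" "j \<in> {..<d (shift g (Inr e))}" "x \<in> carrier Gr"
    have xg: "x \<otimes> g \<in> carrier Gr" using * g by simp
    have j: "j \<in> {..<d (Inr (?e e))}" using * by simp
    have h: "head (?e e) = head e \<otimes> g" by (rule head_shift[OF g *(1)])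
    have t: "cay_tail (?e e) = cay_tail e \<otimes> g" by (simp add: cay_tail_def)
    have "b (Inr (?e e)) j (x \<otimes> g)
      = (\<Sum>l<d (Inl (head (?e e))). \<alpha> (?e e) j l * b (Inl (head (?e e))) l (x \<otimes> g))"
      using pr edges_shift[OF g *(1)] j xg unfolding presented_def by blast
    then show "b (shift g (Inr e)) j (x \<otimes> g)
      = (\<Sum>l<d (shift g (Inl (head e))). \<alpha> (?e e) j l * b (shift g (Inl (head e))) l (x \<otimes> g))"
      by (simp add: h)
    have "b (Inr (?e e)) j (x \<otimes> g)
      = (\<Sum>l<d (Inl (cay_tail (?e e))). \<beta> (?e e) j l * b (Inl (cay_tail (?e e))) l (x \<otimes> g))"
      using pr edges_shift[OF g *(1)] j xg unfolding presented_def by blast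
    then show "b (shift g (Inr e)) j (x \<otimes> g)
      = (\<Sum>l<d (shift g (Inl (cay_tail e))). \<beta> (?e e) j l * b (shift g (Inl (cay_tail e))) l (x \<otimes> g))"
      by (simp add: t)
  qed
  then show ?thesis
    using translate_mats[OF g \<open>M \<in> mats Gr k\<close>] unfolding with_dims_def by blast
qed

lemma polyfun_translate:
  assumes "g \<in> carrier Gr" "p \<in> polyfun Gr k"
  shows "(\<lambda>M. p (translate g M)) \<in> polyfun Gr k"
  using assms(2)
  by induction (use assms(1) in \<open>auto simp: translate_def intro: polyfun.intros\<close>)

text \<open>Translation is an invertible linear substitution: a function nonzero at \<open>N\<close>
  pulls back to one nonzero at the translate of \<open>N\<close> by \<open>inv g\<close>, to which
  density of the original set applies.\<close>

lemma dense_with_dims_shift: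
  fixes d :: "'g + 'g \<times> nat \<Rightarrow> nat"
  assumes g: "g \<in> carrier Gr"
    and dense: "zariski_dense Gr k (with_dims k d :: (nat \<Rightarrow> 'g \<Rightarrow> 'a::field) set)"
  shows "zariski_dense Gr k (with_dims k (d \<circ> shift g) :: (nat \<Rightarrow> 'g \<Rightarrow> 'a) set)"
  unfolding zariski_dense_def
proof (intro conjI ballI impI)
  show "with_dims k (d \<circ> shift g) \<subseteq> mats Gr k" by (auto simp: with_dims_def)
  fix p :: "(nat \<Rightarrow> 'g \<Rightarrow> 'a) \<Rightarrow> 'a" and N :: "nat \<Rightarrow> 'g \<Rightarrow> 'a"
  assume p: "p \<in> polyfun Gr k" "\<forall>M\<in>with_dims k (d \<circ> shift g). p M = 0" and N: "N \<in> mats Gr k"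
  show "p N = 0"
  proof (rule ccontr)
    assume "p N \<noteq> 0"
    then have "p (translate g (translate (inv g) N)) \<noteq> 0" using translate_inv[OF g N] by simp
    then have "\<exists>M\<in>with_dims k d. p (translate g M) \<noteq> 0"
      using zariski_denseD[OF dense polyfun_translate[OF g p(1)], of "translate (inv g) N"]
        translate_mats[OF _ N] g by simp
    then show False using p(2) with_dims_translate[OF g] by blast
  qed
qed

section \<open>Generic surjectivity\<close>

text \<open>The function \<open>q\<close> is a maximal minor on \<open>k\<close> columns chosen from
  \<open>S\<close>; where it does not vanish, these columns already span.\<close>

lemma full_rank_open:
  fixes S :: "'g set"
  assumes S: "S \<subseteq> carrier Gr" "k \<le> card S"
  obtains q and N :: "nat \<Rightarrow> 'g \<Rightarrow> 'a::field"
  where "q \<in> polyfun Gr k" "N \<in> mats Gr k" "q N \<noteq> 0"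
    "\<And>M v. q M \<noteq> 0 \<Longrightarrow> \<exists>a. \<forall>i<k. v i = (\<Sum>x\<in>S. a x * M i x)"
proof -
  have finS: "finite S" using S finite_carrier finite_subset by blast
  obtain T where T: "T \<subseteq> S" "card T = k" using obtain_subset_with_card_n[OF S(2)] by auto
  have finT: "finite T" using T finS finite_subset by blast
  obtain f where f: "bij_betw f {0..<k} T" using ex_bij_betw_nat_finite[OF finT] T by auto
  then have inj: "inj_on f {0..<k}" and im: "f ` {0..<k} = T" by (auto simp: bij_betw_def)
  define A where "A M = mat k k (\<lambda>(i, j). M i (f j))" for M :: "nat \<Rightarrow> 'g \<Rightarrow> 'a"
  have A: "A M \<in> carrier_mat k k" for M by (simp add: A_def)
  \<comment> \<open>The chosen columns of \<open>N\<close> form the identity matrix, so the minor is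
    not identically zero.\<close>
  define N :: "nat \<Rightarrow> 'g \<Rightarrow> 'a" where "N = (\<lambda>i x. if i < k \<and> x = f i then 1 else 0)"
  have fS: "f j \<in> carrier Gr" if "j < k" for j using bij_betwE[OF f] that subsetD[OF T(1)] subsetD[OF S(1)] by simp
  show ?thesis
  proof (rule that[of "\<lambda>M. det (A M)" N])
    have det: "det (A M) = (\<Sum>p | p permutes {0..<k}. signof p * (\<Prod>i\<in>{0..<k}. M i (f (p i))))" for M
      unfolding det_def'[OF A] by (rule sum.cong) (auto simp: A_def permutes_in_image intro!: prod.cong)
    have "p i < k" if "p permutes {0..<k}" "i < k" for p i
      using permutes_in_image[OF that(1), of i] that(2) by simp
    then show "(\<lambda>M. det (A M)) \<in> polyfun Gr k"
      unfolding det
      by (intro polyfun_sum polyfun_prod polyfun.pf_mult polyfun.pf_const polyfun.pf_var) (auto intro!: fS)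
    show "N \<in> mats Gr k" using fS by (auto simp: mats_def N_def)
    have "A N = 1\<^sub>m k"
      by (rule eq_matI) (use inj in \<open>auto simp: A_def N_def inj_on_def\<close>)
    then show "det (A N) \<noteq> 0" by simp
    fix M :: "nat \<Rightarrow> 'g \<Rightarrow> 'a" and v :: "nat \<Rightarrow> 'a"
    assume "det (A M) \<noteq> 0"
    from det_non_zero_imp_unit[OF A this, of "()"]
    obtain B where B: "B \<in> carrier_mat k k" "A M * B = 1\<^sub>m k"
      by (auto simp: Units_def ring_mat_def)
    define w where "w = B *\<^sub>v vec k v"
    have w: "A M *\<^sub>v w = vec k v"
      unfolding w_def using B by (subst assoc_mult_mat_vec[symmetric, OF A B(1)]) auto
    define g where "g = the_inv_into {0..<k} f"
    have gf: "g (f j) = j" if "j < k" for j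
      unfolding g_def using the_inv_into_f_f[OF inj] that by simp
    define a where "a x = (if x \<in> T then w $ g x else 0)" for x
    have "v i = (\<Sum>x\<in>S. a x * M i x)" if "i < k" for i
    proof -
      have dw: "dim_vec w = k" using B by (simp add: w_def)
      have "v i = (A M *\<^sub>v w) $ i" using that w by simp
      also have "\<dots> = (\<Sum>j\<in>{0..<k}. M i (f j) * w $ j)"
        using that dw by (simp add: A_def scalar_prod_def)
      also have "\<dots> = (\<Sum>j\<in>{0..<k}. a (f j) * M i (f j))"
        by (rule sum.cong) (use im in \<open>auto simp: a_def gf\<close>)
      also have "\<dots> = (\<Sum>x\<in>T. a x * M i x)" by (rule sum.reindex_bij_betw[OF f])
      also have "\<dots> = (\<Sum>x\<in>S. a x * M i x)"
        by (rule sum.mono_neutral_left[OF finS T(1)]) (simp add: a_def)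
      finally show ?thesis .
    qed
    then show "\<exists>a. \<forall>i<k. v i = (\<Sum>x\<in>S. a x * M i x)" by blast
  qed
qed

text \<open>Each point asks for a nonvanishing minor, and irreducibility lets finitely many such
  conditions hold together.\<close>

lemma L_surjective_dense:
  assumes inf: "infinite (UNIV :: 'a::field set)"
    and card: "\<And>P. P \<in> pts \<Longrightarrow> k \<le> card (GL Gr VL EL P)"
  shows "zariski_dense Gr k {M :: nat \<Rightarrow> 'g \<Rightarrow> 'a. M \<in> mats Gr k \<and> L_surjective Gr VL EL k M}"
  unfolding zariski_dense_def
proof (intro conjI ballI impI)
  fix p :: "(nat \<Rightarrow> 'g \<Rightarrow> 'a) \<Rightarrow> 'a" and M0 :: "nat \<Rightarrow> 'g \<Rightarrow> 'a"
  assume p: "p \<in> polyfun Gr k" "\<forall>M\<in>{M. M \<in> mats Gr k \<and> L_surjective Gr VL EL k M}. p M = 0"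
    and M0: "M0 \<in> mats Gr k"
  show "p M0 = 0"
  proof (rule ccontr)
    assume "p M0 \<noteq> 0"
    \<comment> \<open>The induction over points starts from \<open>q = p\<close>, so nonvanishing of
      the accumulated product also keeps \<open>p\<close> nonzero.\<close>
    have "\<exists>q N. q \<in> polyfun Gr k \<and> N \<in> mats Gr k \<and> q N \<noteq> 0 \<and>
      (\<forall>M. q M \<noteq> 0 \<longrightarrow> p M \<noteq> 0 \<and>
        (\<forall>P\<in>Q. \<forall>v. \<exists>a. \<forall>i<k. v i = (\<Sum>x\<in>GL Gr VL EL P. a x * M i x)))"
      if "finite Q" "Q \<subseteq> pts" for Q
      using that
    proof (induction Q rule: finite_induct)
      case empty
      show ?case using p(1) M0 \<open>p M0 \<noteq> 0\<close> by auto
    next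
      case (insert P Q)
      then obtain q N where q: "q \<in> polyfun Gr k" "N \<in> mats Gr k" "q N \<noteq> 0"
        "\<And>M. q M \<noteq> 0 \<Longrightarrow> p M \<noteq> 0 \<and>
          (\<forall>P\<in>Q. \<forall>v. \<exists>a. \<forall>i<k. v i = (\<Sum>x\<in>GL Gr VL EL P. a x * M i x))" by auto
      obtain r N' where r: "r \<in> polyfun Gr k" "N' \<in> mats Gr k" "r N' \<noteq> (0::'a)"
        "\<And>M v. r M \<noteq> 0 \<Longrightarrow> \<exists>a. \<forall>i<k. v i = (\<Sum>x\<in>GL Gr VL EL P. a x * M i x)"
        by (rule full_rank_open[OF GL_subset card[of P]]) (use insert.prems in auto)
      obtain R where "R \<in> mats Gr k" "q R \<noteq> 0" "r R \<noteq> 0"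
        using polyfun_common_nonzero[OF inf q(1-3) r(1-3)] by auto
      then show ?case
        using polyfun.pf_mult[OF q(1) r(1)] q(4) r(4)
        by (intro exI[of _ "\<lambda>M. q M * r M"] exI[of _ R]) simp
    qed
    from this[OF finite_pts subset_refl] obtain q N where
      q: "q \<in> polyfun Gr k" "N \<in> mats Gr k" "q N \<noteq> 0"
        "\<And>M. q M \<noteq> 0 \<Longrightarrow> p M \<noteq> 0 \<and>
          (\<forall>P\<in>pts. \<forall>v. \<exists>a. \<forall>i<k. v i = (\<Sum>x\<in>GL Gr VL EL P. a x * M i x))" by auto
    have "L_surjective Gr VL EL k N" using q(4)[OF q(3)] unfolding L_surjective_def by simp
    then show False using p(2) q(2) q(4)[OF q(3)] by simp
  qed
qed auto

section \<open>Every point lies in at least \<open>k\<close> translates\<close>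

lemma finite_VL: "finite VL" and finite_EL: "finite EL"
  using subgraph finite_carrier finite_edges by (auto simp: is_subgraph_def intro: finite_subset)

text \<open>Translating by \<open>inv h \<otimes> v\<close> moves the vertex \<open>h\<close> of
  \<open>L\<close> to \<open>v\<close>, and different \<open>h\<close> need different
  translations.\<close>

lemma card_VL_le_GL:
  assumes "v \<in> carrier Gr"
  shows "card VL \<le> card (GL Gr VL EL (Inl v))"
proof (rule card_inj_on_le)
  show "inj_on (\<lambda>h. inv h \<otimes> v) VL"
    using assms VL_carrier inj_on_eq_iff[OF inv_inj] by (auto simp: inj_on_def)
  show "(\<lambda>h. inv h \<otimes> v) ` VL \<subseteq> GL Gr VL EL (Inl v)"
  proof clarify
    fix h assume h: "h \<in> VL"
    have "v = h \<otimes> (inv h \<otimes> v)" using VL_carrier[OF h] assms by (simp flip: m_assoc)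
    then show "inv h \<otimes> v \<in> GL Gr VL EL (Inl v)"
      using h VL_carrier[OF h] assms unfolding GL_Inl by auto
  qed
  show "finite (GL Gr VL EL (Inl v))" by (rule finite_subset[OF GL_subset finite_carrier])
qed

lemma card_EL_le_GL:
  assumes "u \<in> carrier Gr"
  shows "card {h. (h, i) \<in> EL} \<le> card (GL Gr VL EL (Inr (u, i)))"
proof (rule card_inj_on_le)
  show "inj_on (\<lambda>h. inv h \<otimes> u) {h. (h, i) \<in> EL}"
    using assms EL_carrier inj_on_eq_iff[OF inv_inj] by (auto simp: inj_on_def)
  show "(\<lambda>h. inv h \<otimes> u) ` {h. (h, i) \<in> EL} \<subseteq> GL Gr VL EL (Inr (u, i))"
  proof clarify
    fix h assume h: "(h, i) \<in> EL"
    have "u = h \<otimes> (inv h \<otimes> u)" using EL_carrier[OF h] assms by (simp flip: m_assoc)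
    then show "inv h \<otimes> u \<in> GL Gr VL EL (Inr (u, i))"
      using h EL_carrier[OF h] assms unfolding GL_Inr by auto
  qed
  show "finite (GL Gr VL EL (Inr (u, i)))" by (rule finite_subset[OF GL_subset finite_carrier])
qed

lemma components_disjoint:
  assumes "X \<in> components Gr g1 g2 VL EL" "Y \<in> components Gr g1 g2 VL EL" "X \<noteq> Y"
  shows "X \<inter> Y = {}"
proof -
  let ?r = "und_adj Gr g1 g2 EL"
  have "symp ?r" by (auto simp: symp_def und_adj_def)
  then have sym: "?r\<^sup>*\<^sup>* a b \<Longrightarrow> ?r\<^sup>*\<^sup>* b a" for a b by (metis symp_rtranclp sympD)
  obtain u v where uv: "X = {w \<in> VL. ?r\<^sup>*\<^sup>* u w}" "Y = {w \<in> VL. ?r\<^sup>*\<^sup>* v w}"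
    using assms unfolding components_def by auto
  have "X = Y" if "w \<in> X" "w \<in> Y" for w
  proof -
    have "?r\<^sup>*\<^sup>* u v" using that sym uv by (auto intro: rtranclp_trans)
    then have "?r\<^sup>*\<^sup>* u a \<longleftrightarrow> ?r\<^sup>*\<^sup>* v a" for a using sym by (meson rtranclp_trans)
    then show ?thesis unfolding uv by simp
  qed
  then show ?thesis using assms(3) by blast
qed

text \<open>A vertex has at most one outgoing edge of each colour. In a component the edges of the
  other colour are therefore no more than the vertices, so the surplus of edges is at most the
  number of edges of colour \<open>i\<close>; components are disjoint, so these numbers add
  up.\<close>

lemma rho_le:
  assumes i: "i \<in> {1, 2}"
  shows "rho Gr g1 g2 VL EL \<le> int (card {h. (h, i) \<in> EL})"
proof -
  let ?C = "components Gr g1 g2 VL EL"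
  have XV: "X \<subseteq> VL" if "X \<in> ?C" for X using that by (auto simp: components_def)
  have finX: "finite X" if "X \<in> ?C" for X using XV[OF that] finite_VL finite_subset by blast
  have finC: "finite ?C" using finite_VL by (simp add: components_def)
  let ?E = "\<lambda>X j. {h \<in> X. (h, j) \<in> EL}"
  have le: "max 0 (int (card {e \<in> EL. cay_tail e \<in> X}) - int (card X)) \<le> int (card (?E X i))"
    if X: "X \<in> ?C" for X
  proof -
    have EX: "card (?E X j) \<le> card X" for j by (rule card_mono[OF finX[OF X]]) auto
    have "{e \<in> EL. cay_tail e \<in> X} \<subseteq> (\<lambda>h. (h, 1)) ` ?E X 1 \<union> (\<lambda>h. (h, 2)) ` ?E X 2"
    proof
      fix e assume e: "e \<in> {e \<in> EL. cay_tail e \<in> X}"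
      then have "e \<in> edges" using subgraph by (auto simp: is_subgraph_def)
      then show "e \<in> (\<lambda>h. (h, 1)) ` ?E X 1 \<union> (\<lambda>h. (h, 2)) ` ?E X 2"
        using e by (auto simp: cay_edges_def cay_tail_def)
    qed
    then have "card {e \<in> EL. cay_tail e \<in> X} \<le> card ((\<lambda>h. (h, 1::nat)) ` ?E X 1 \<union> (\<lambda>h. (h, 2)) ` ?E X 2)"
      using finX[OF X] by (intro card_mono) auto
    also have "\<dots> \<le> card ((\<lambda>h. (h, 1::nat)) ` ?E X 1) + card ((\<lambda>h. (h, 2::nat)) ` ?E X 2)"
      by (rule card_Un_le)
    also have "\<dots> \<le> card (?E X 1) + card (?E X 2)"
      using finX[OF X] by (intro add_mono card_image_le) auto
    finally show ?thesis using EX[of 1] EX[of 2] i by auto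
  qed
  have "rho Gr g1 g2 VL EL \<le> (\<Sum>X\<in>?C. int (card (?E X i)))"
    unfolding rho_def by (rule sum_mono) (rule le)
  also have "\<dots> = int (\<Sum>X\<in>?C. card (?E X i))" by simp
  also have "(\<Sum>X\<in>?C. card (?E X i)) = card (\<Union>X\<in>?C. ?E X i)"
    using finC finX components_disjoint by (intro card_UN_disjoint[symmetric]) auto
  also have "\<dots> \<le> card {h. (h, i) \<in> EL}"
  proof (rule card_mono)
    have "{h. (h, i) \<in> EL} \<subseteq> fst ` EL" by force
    then show "finite {h. (h, i) \<in> EL}" using finite_EL finite_subset by blast
  qed auto
  finally show ?thesis by simp
qed

lemma card_EL_le_VL: "card {h. (h, i) \<in> EL} \<le> card VL"
  using subgraph by (intro card_mono finite_VL) (auto simp: is_subgraph_def cay_tail_def)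

text \<open>An edge needs the bound for its own colour, which is why \<open>rho_le\<close> treats
  both. For a vertex, the edges of one colour are compared with the vertices of \<open>L\<close>
  through their tails.\<close>

lemma le_card_GL:
  assumes "int k \<le> rho Gr g1 g2 VL EL" "P \<in> pts"
  shows "k \<le> card (GL Gr VL EL P)"
proof (cases P)
  case (Inl v)
  then show ?thesis
    using assms rho_le[of 1] card_EL_le_VL[of 1] card_VL_le_GL[of v] by simp
next
  case (Inr e)
  then obtain u i where "e = (u, i)" "u \<in> carrier Gr" "i \<in> {1, 2}"
    using assms by (auto simp: cay_edges_def)
  then show ?thesis using Inr assms(1) rho_le[of i] card_EL_le_GL[of u i] by auto
qed

section \<open>Translation invariance of the least maximiser\<close>

lemma bij_edges_shift:
  "g \<in> carrier Gr \<Longrightarrow> bij_betw (\<lambda>e. (fst e \<otimes> g, snd e)) edges edges"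
  by (rule bij_betwI[where g = "\<lambda>e. (fst e \<otimes> inv g, snd e)"]) (auto simp: m_assoc cay_edges_def)

lemma excess_shift:
  assumes "g \<in> carrier Gr"
  shows "excess (carrier Gr) edges (d \<circ> shift g) = excess (carrier Gr) edges d"
  using sum.reindex_bij_betw[OF bij_edges_shift[OF assms], of "\<lambda>e. int (d (Inr e))"]
    sum_shift[OF assms, of "\<lambda>v. int (d (Inl v))"]
  by (simp add: excess_def)

text \<open>The inequality for \<open>inv g\<close> at the translated point is the reverse one, so
  \<open>d\<close> is constant on orbits. Divided by the group order, the excess is that of a
  dimension vector on a graph with one vertex and two loops.\<close>

lemma excess_invariant:
  assumes "\<And>g P. g \<in> carrier Gr \<Longrightarrow> P \<in> pts \<Longrightarrow> d P \<le> d (shift g P)"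
  shows "int (card (carrier Gr)) dvd excess (carrier Gr) edges d"
proof -
  have eq: "d (shift g P) = d P" if g: "g \<in> carrier Gr" and P: "P \<in> pts" for g P
  proof (rule antisym)
    show "d P \<le> d (shift g P)" by (rule assms[OF g P])
    have "d (shift g P) \<le> d (shift (inv g) (shift g P))"
      using g P by (intro assms pts_shift) auto
    also have "shift (inv g) (shift g P) = P"
      using g P by (cases P) (auto simp: m_assoc cay_edges_def)
    finally show "d (shift g P) \<le> d P" .
  qed
  have V: "d (Inl v) = d (Inl \<one>)" if "v \<in> carrier Gr" for v
    using eq[of v "Inl \<one>"] that by simp
  have E: "d (Inr (u, i)) = d (Inr (\<one>, i))" if "u \<in> carrier Gr" "i \<in> {1, 2}" for u i
    using eq[of u "Inr (\<one>, i)"] that by (simp add: cay_edges_def)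
  have "excess (carrier Gr) edges d = (\<Sum>u\<in>carrier Gr. \<Sum>i\<in>{1, 2}. int (d (Inr (u, i))))
    - (\<Sum>v\<in>carrier Gr. int (d (Inl v)))"
    by (simp add: excess_def cay_edges_def sum.cartesian_product del: sum.insert)
  also have "\<dots> = (\<Sum>u\<in>carrier Gr. \<Sum>i\<in>{1, 2}. int (d (Inr (\<one>, i))))
    - (\<Sum>v\<in>carrier Gr. int (d (Inl \<one>)))"
  proof (intro arg_cong2[where f = "(-)"] sum.cong refl)
    show "int (d (Inr (u, i))) = int (d (Inr (\<one>, i)))" if "u \<in> carrier Gr" "i \<in> {1, 2}" for u i
      using E[OF that] by simp
    show "int (d (Inl v)) = int (d (Inl \<one>))" if "v \<in> carrier Gr" for v
      using V[OF that] by simp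
  qed
  also have "\<dots> = int (card (carrier Gr)) * ((\<Sum>i\<in>{1, 2}. int (d (Inr (\<one>, i)))) - int (d (Inl \<one>)))"
    by (simp add: right_diff_distrib)
  finally show ?thesis by simp
qed

section \<open>Divisibility of the generic value\<close>

lemma generic_me_dvd:
  assumes ac: "algebraically_closed TYPE('a::field)" and k: "int k \<le> rho Gr g1 g2 VL EL"
  shows "int (card (carrier Gr)) dvd generic_me TYPE('a) Gr g1 g2 VL EL k"
proof -
  note inf = algebraically_closed_infinite[OF ac]
  define me where "me M = me_K Gr g1 g2 VL EL k M" for M :: "nat \<Rightarrow> 'g \<Rightarrow> 'a"
  define sub where "sub M A \<longleftrightarrow> subsheaf (carrier Gr) edges head cay_tail (K_sheaf Gr VL EL k M) A"
    for M :: "nat \<Rightarrow> 'g \<Rightarrow> 'a" and A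
  define ex where "ex d = excess (carrier Gr) edges d" for d :: "'g + 'g \<times> nat \<Rightarrow> nat"
  define S where "S m = {M :: nat \<Rightarrow> 'g \<Rightarrow> 'a. M \<in> mats Gr k \<and> L_surjective Gr VL EL k M \<and> me M \<ge> m}" for m
  define b where "b = int (card edges * card (carrier Gr))"
  note fs = finite_sheaf_K[where k = k and ?'a = 'a]
  have me: "0 \<le> me M" "me M \<le> b" for M
    using finite_sheaf.me_nonneg[OF fs, of M] finite_sheaf.me_le[OF fs, of M]
    by (simp_all add: me_def me_K_def b_def)
  \<comment> \<open>As the maximum excess is never negative, level 0 imposes surjectivity
    alone.\<close>
  have S0: "zariski_dense Gr k (S 0)"
    using L_surjective_dense[OF inf le_card_GL[OF k]] by (simp add: S_def me)
  have Sb: "m \<le> b" if "zariski_dense Gr k (S m)" for m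
  proof -
    obtain M where "M \<in> S m" using zariski_dense_nonempty[OF \<open>zariski_dense Gr k (S m)\<close>] by auto
    then have "m \<le> me M" by (simp add: S_def)
    then show ?thesis using me(2)[of M] by linarith
  qed
  \<comment> \<open>All negative levels are admissible too; cutting off at 0 leaves a finite set,
    whose maximum is the value of \<open>GREATEST\<close>.\<close>
  define D where "D = {m \<in> {0..b}. zariski_dense Gr k (S m)}"
  have "finite D" by (rule finite_subset[of _ "{0..b}"]) (auto simp: D_def)
  moreover have "0 \<in> D" using S0 Sb[OF S0] by (simp add: D_def)
  ultimately have D: "finite D" "0 \<in> D" by simp_all
  define m where "m = Max D"
  have "m \<in> D" unfolding m_def using D by (intro Max_in) auto
  then have Sm: "zariski_dense Gr k (S m)" "0 \<le> m" by (auto simp: D_def)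
  have max: "m' \<le> m" if "zariski_dense Gr k (S m')" for m'
  proof (cases "0 \<le> m'")
    case True
    then have "m' \<in> D" using that Sb[OF that] by (simp add: D_def)
    then show ?thesis unfolding m_def using D(1) by simp
  qed (use Sm in simp)
  have generic: "generic_me TYPE('a) Gr g1 g2 VL EL k = m"
    unfolding generic_me_def using Sm(1) max
    by (intro Greatest_equality) (simp_all add: S_def me_def)
  \<comment> \<open>Minimality is recorded as a bound on the vector \<open>d\<close> against every
    subsheaf of excess \<open>m\<close>, so that a subsheaf constructed from other data can be
    compared with it.\<close>
  define T where "T d = {M \<in> mats Gr k. me M = m \<and> (\<exists>A. sub M A \<and> ex (\<lambda>P. G.dim (A P)) = m \<and>
    (\<forall>P\<in>pts. G.dim (A P) = d P) \<and>
    (\<forall>B. sub M B \<and> ex (\<lambda>P. G.dim (B P)) = m \<longrightarrow> (\<forall>P\<in>pts. d P \<le> G.dim (B P))))}" for d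
  \<comment> \<open>Extensional functions, so that only finitely many candidate vectors occur; a
    stalk has dimension at most the group order.\<close>
  define I where "I = pts \<rightarrow>\<^sub>E {..card (carrier Gr)}"
  have finI: "finite I" unfolding I_def by (rule finite_PiE[OF finite_pts]) simp
  have ex_cong: "ex d = ex d'" if "\<And>P. P \<in> pts \<Longrightarrow> d P = d' P" for d d'
    unfolding ex_def excess_def using that by simp
  have cover: "S m \<subseteq> S (m + 1) \<union> (\<Union>d\<in>I. T d)"
  proof
    fix M assume M: "M \<in> S m"
    show "M \<in> S (m + 1) \<union> (\<Union>d\<in>I. T d)"
    proof (cases "me M = m")
      case False
      then show ?thesis using M by (auto simp: S_def)
    next
      case True
      interpret F: finite_sheaf "carrier Gr" edges head cay_tail "carrier Gr" "K_sheaf Gr VL EL k M"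
        by (rule fs)
      have Fme: "F.me = m" using True by (simp add: me_def me_K_def)
      obtain A where A: "F.sub A" "F.ex A = F.me"
        "\<And>B P. F.sub B \<Longrightarrow> F.ex B = F.me \<Longrightarrow> P \<in> points (carrier Gr) edges \<Longrightarrow> G.dim (A P) \<le> G.dim (B P)"
        by (rule F.least_maximiser) (rule that)
      define d where "d = restrict (\<lambda>P. G.dim (A P)) pts"
      have "d \<in> I"
        unfolding I_def d_def using F.sub_dim_le[OF A(1)] by (auto simp: pts_eq)
      moreover have "M \<in> T d"
        unfolding T_def
      proof (intro CollectI conjI exI[of _ A])
        show "M \<in> mats Gr k" using M by (simp add: S_def)
        show "me M = m" by (rule True)
        show "sub M A" using A(1) by (simp add: sub_def)
        show "ex (\<lambda>P. G.dim (A P)) = m" using A(2) Fme by (simp add: ex_def)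
        show "\<forall>P\<in>pts. G.dim (A P) = d P" by (simp add: d_def)
        show "\<forall>B. sub M B \<and> ex (\<lambda>P. G.dim (B P)) = m \<longrightarrow> (\<forall>P\<in>pts. d P \<le> G.dim (B P))"
          using A(3) Fme by (simp add: sub_def ex_def d_def pts_eq)
      qed
      ultimately show ?thesis by blast
    qed
  qed
  have "zariski_dense Gr k (S (m + 1) \<union> (\<Union>d\<in>I. T d))"
    by (rule zariski_dense_mono[OF Sm(1) cover]) (auto simp: S_def T_def)
  \<comment> \<open>By maximality of \<open>m\<close> the matrices of larger excess are not dense,
    so irreducibility passes density to those of excess exactly \<open>m\<close>.\<close>
  moreover have "\<not> zariski_dense Gr k (S (m + 1))" using max[of "m + 1"] by auto
  ultimately have "zariski_dense Gr k (\<Union>d\<in>I. T d)" using zariski_dense_Un[OF inf] by blast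
  from zariski_dense_UN[OF inf finI this]
  obtain d where d: "zariski_dense Gr k (T d)" by (rule bexE)
  have exd: "ex d = m"
  proof -
    obtain M where "M \<in> T d" using zariski_dense_nonempty[OF d] by auto
    then obtain A where "sub M A" "ex (\<lambda>P. G.dim (A P)) = m" "\<forall>P\<in>pts. G.dim (A P) = d P"
      by (auto simp: T_def)
    then show ?thesis using ex_cong[of "\<lambda>P. G.dim (A P)" d] by simp
  qed
  have "T d \<subseteq> with_dims k d"
  proof
    fix M assume "M \<in> T d"
    then obtain A where "M \<in> mats Gr k" "sub M A" "\<forall>P\<in>pts. G.dim (A P) = d P"
      by (auto simp: T_def)
    then show "M \<in> with_dims k d" by (intro with_dimsI[of M k A]) (simp_all add: sub_def)
  qed
  then have dense: "zariski_dense Gr k (with_dims k d :: (nat \<Rightarrow> 'g \<Rightarrow> 'a) set)"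
    by (rule zariski_dense_mono[OF d]) (auto simp: with_dims_def)
  have "d P \<le> d (shift g P)" if g: "g \<in> carrier Gr" and P: "P \<in> pts" for g P
  proof -
    obtain q and N :: "nat \<Rightarrow> 'g \<Rightarrow> 'a" where q: "q \<in> polyfun Gr k" "N \<in> mats Gr k" "q N \<noteq> 0"
      "\<And>M. M \<in> mats Gr k \<Longrightarrow> q M \<noteq> 0 \<Longrightarrow> M \<in> with_dims k (d \<circ> shift g)"
      by (rule with_dims_open[OF ac dense_with_dims_shift[OF g dense]]) (rule that)
    \<comment> \<open>The dense set \<open>T d\<close> meets the open set where \<open>q\<close> is
      nonzero: this one matrix has \<open>d\<close> as least vector and also admits the translated
      dimensions.\<close>
    obtain M where M: "M \<in> T d" "q M \<noteq> 0" using zariski_denseD[OF d q(1-3)] by auto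
    then have "M \<in> with_dims k (d \<circ> shift g)" using q(4) by (simp add: T_def)
    then obtain B where B: "sub M B" "\<And>P. P \<in> pts \<Longrightarrow> G.dim (B P) = (d \<circ> shift g) P"
      by (rule with_dimsE) (rule that, simp add: sub_def)
    have "ex (\<lambda>P. G.dim (B P)) = ex (d \<circ> shift g)" by (rule ex_cong) (rule B(2))
    also have "\<dots> = m" using excess_shift[OF g, of d] exd by (simp add: ex_def)
    finally have "ex (\<lambda>P. G.dim (B P)) = m" .
    then have "d P \<le> G.dim (B P)" using M(1) B(1) P by (auto simp: T_def)
    then show ?thesis using B(2)[OF P] by simp
  qed
  from excess_invariant[OF this] show ?thesis using generic exd by (simp add: ex_def)
qed

end

theorem theorem2:
  fixes Gr :: "('g, 'b) monoid_scheme" and g1 g2 :: 'g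
    and VL :: "'g set" and EL :: "('g \<times> nat) set" and k :: nat
  assumes "algebraically_closed TYPE('a::field)"
    and "group Gr" and "finite (carrier Gr)"
    and "g1 \<in> carrier Gr" and "g2 \<in> carrier Gr"
    and "is_subgraph Gr g1 g2 VL EL"
    and "int k \<le> rho Gr g1 g2 VL EL"
  shows "int (card (carrier Gr)) dvd generic_me TYPE('a) Gr g1 g2 VL EL k"
proof -
  interpret cayley_bigraph Gr g1 g2 VL EL
    using assms by (simp add: cayley_bigraph_def cayley_bigraph_axioms_def)
  show ?thesis by (rule generic_me_dvd[OF assms(1,7)])
qed

end
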